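(* Consider the discrete-time linear time-invariant system $$x_{k+1}=Ax_k+Bu_k,\qquad y_k=Cx_k+Du_k,$$ with $x_k\in\mathbb{R}^n$, $u_k\in\mathbb{R}^m$, $y_k\in\mathbb{R}^p$, unknown matrices $(A,B,C,D)$, $(A,B)$ controllable and $(A,C)$ observable. Let $l\geq \underline{l}$ be an integer, where $\underline{l}$ is the lag of the system, and let $\xi_t=\begin{bmatrix}u_{[t-l,t-1]}\\ y_{[t-l,t-1]}\end{bmatrix}\in\mathbb{R}^{n_\xi}$, $n_\xi=(m+p)l$, be the extended state, which evolves according to the extended dynamics $\xi_{k+1}=\tilde A\xi_k+\tilde Bu_k$, $y_k=\tilde C\xi_k+\tilde Du_k$ described in the context. Let $\{u_k^d,y_k^d\}_{k=0}^{N-1}$ be an input-output trajectory of the system, let $\mathbb{U}\subseteq\mathbb{R}^m$, $\mathbb{Y}\subseteq\mathbb{R}^p$ be constraint sets, let $(u^s,y^s)\in\mathrm{int}(\mathbb{U}\times\mathbb{Y})$ be an equilibrium of the system with corresponding extended steady state $\xi^s=\begin{bmatrix}u^s\\ \vdots\\ u^s\\ y^s\\ \vdots\\ y^s\end{bmatrix}$, let $Q\succ0$, $R\succ0$, and let $L\in\mathbb{I}_{\geq1}$. Suppose that: (A1) there exist $P=P^\top\succ0$, $K\in\mathbb{R}^{m\times n_\xi}$ and a set $\Xi_f\subseteq\mathbb{U}^l\times\mathbb{Y}^l$ with $\xi^s\in\mathrm{int}(\Xi_f)$ such that for all $\xi\in\Xi_f$, with $u=u^s+K(\xi-\xi^s)$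 and $y=\tilde C\xi+\tilde Du$, we have (i) $\tilde A\xi+\tilde Bu\in\Xi_f$; (ii) $u\in\mathbb{U}$ and $y\in\mathbb{Y}$; (iii) $\lVert(\tilde A+\tilde BK)(\xi-\xi^s)\rVert_P^2\leq\lVert\xi-\xi^s\rVert_P^2-\lVert\xi-\xi^s\rVert_{K^\top RK}^2-\lVert y-y^s\rVert_Q^2$; (A2) there exists $c_u>0$ such that $J_L^*(\xi)\leq c_u\lVert\xi-\xi^s\rVert_2^2$ for all $\xi$ for which the optimal control problem below is feasible; (A3) the input $u^d$ is persistently exciting of order $L+l+n$. At each time $t\in\mathbb{I}_{\geq0}$, given the past $l$ closed-loop measurements $u_{[t-l,t-1]}$, $y_{[t-l,t-1]}$ (i.e., $\xi_t$), solve $$\min_{\alpha(t),\bar u(t),\bar y(t)}\ \sum_{k=0}^{L-1}\Big(\lVert\bar u_k(t)-u^s\rVert_R^2+\lVert\bar y_k(t)-y^s\rVert_Q^2\Big)+\lVert\bar\xi_L(t)-\xi^s\rVert_P^2$$ subject to $\begin{bmatrix}\bar u_{[-l,L-1]}(t)\\ \bar y_{[-l,L-1]}(t)\end{bmatrix}=\begin{bmatrix}H_{L+l}(u^d)\\ H_{L+l}(y^d)\end{bmatrix}\alpha(t)$, $\ \begin{bmatrix}\bar u_{[-l,-1]}(t)\\ \bar y_{[-l,-1]}(t)\end{bmatrix}=\begin{bmatrix}u_{[t-l,t-1]}\\ y_{[t-l,t-1]}\end{bmatrix}$, $\ \bar\xi_L(t)=\begin{bmatrix}\bar u_{[L-l,L-1]}(t)\\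 \bar y_{[L-l,L-1]}(t)\end{bmatrix}\in\Xi_f$, and $\bar u_k(t)\in\mathbb{U}$, $\bar y_k(t)\in\mathbb{Y}$ for $k\in\mathbb{I}_{[0,L-1]}$, and apply $u_t=\bar u_0^*(t)$, where $\bar u^*(t)$ is an optimal solution; $J_L^*(\xi_t)$ denotes the optimal value. If this problem is feasible at the initial time $t=0$, then (i) it is feasible at every $t\in\mathbb{I}_{\geq0}$; (ii) the closed-loop trajectory satisfies $u_t\in\mathbb{U}$ and $y_t\in\mathbb{Y}$ for all $t\in\mathbb{I}_{\geq0}$; (iii) the equilibrium $\xi^s$ is exponentially stable for the resulting closed loop (in the extended state $\xi_t$).
   Context: Notation: $\mathbb{I}_{[a,b]}$ is the set of integers in $[a,b]$, $\mathbb{I}_{\geq0}$ the nonnegative integers; $\lVert x\rVert_P^2=x^\top Px$. For a sequence $\{x_k\}_{k=0}^{N-1}$, $x_{[a,b]}=\begin{bmatrix}x_a^\top&\dots&x_b^\top\end{bmatrix}^\top$ and $x=x_{[0,N-1]}$. The Hankel matrix of depth $L$ is $H_L(x)=\begin{bmatrix}x_0&x_1&\dots&x_{N-L}\\ x_1&x_2&\dots&x_{N-L+1}\\ \vdots&&&\vdots\\ x_{L-1}&x_L&\dots&x_{N-1}\end{bmatrix}$. A sequence $\{u_k,y_k\}$ is a trajectory of the system if there is an initial state $x_0$ such that the system equations hold. $\{u_k\}_{k=0}^{N-1}$, $u_k\in\mathbb{R}^m$, is persistently exciting of order $L$ if $\mathrm{rank}(H_L(u))=mL$. The lag $\underline{l}$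 is the smallest $l\in\mathbb{I}_{[1,n]}$ such that $\Phi_l=\begin{bmatrix}C^\top&(CA)^\top&\dots&(CA^{l-1})^\top\end{bmatrix}^\top$ has rank $n$. $(u^s,y^s)$ is an equilibrium if the constant sequence $(\bar u_k,\bar y_k)=(u^s,y^s)$, $k\in\mathbb{I}_{[0,\underline{l}]}$, is a trajectory of the system. Extended dynamics: for $l\geq\underline{l}$ there exist matrices $G_1,\dots,G_l\in\mathbb{R}^{p\times m}$, $F_1,\dots,F_l\in\mathbb{R}^{p\times p}$ such that every trajectory satisfies $y_k=\sum_{i=1}^l G_iu_{k-i}+\sum_{i=1}^l F_iy_{k-i}+Du_k$; correspondingly $\xi_{k+1}=\tilde A\xi_k+\tilde Bu_k$, $y_k=\tilde C\xi_k+\tilde Du_k$, where $\tilde A$ shifts the input blocks and output blocks of $\xi_k$ up by one (dropping $u_{k-l}$, $y_{k-l}$), sets the new last input block to $0$ and the new last output block to $\tilde C\xi_k$, with $\tilde C=\begin{bmatrix}G_l&\dots&G_1&F_l&\dots&F_1\end{bmatrix}$, $\tilde D=D$, and $\tilde B$ has $I$ in the last input block, $D$ in the last output block and zeros elsewhere. The closed-loop extended state is $\xi_t=\begin{bmatrix}u_{[t-l,t-1]}^\top& y_{[t-l,t-1]}^\top\end{bmatrix}^\top$. *)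

theory Defs
  imports Complex_Main "Jordan_Normal_Form.DL_Rank"
begin

definition mrank :: "real mat \<Rightarrow> nat" where
  "mrank M = vec_space.rank (dim_row M) M"

definition vnorm :: "real vec \<Rightarrow> real" where
  "vnorm x = sqrt (x \<bullet> x)"

definition qf :: "real mat \<Rightarrow> real vec \<Rightarrow> real" where
  "qf M x = x \<bullet> (M *\<^sub>v x)"

definition pos_def :: "nat \<Rightarrow> real mat \<Rightarrow> bool" where
  "pos_def d M \<longleftrightarrow> M \<in> carrier_mat d d \<and> transpose_mat M = M \<and>
     (\<forall>x \<in> carrier_vec d. x \<noteq> 0\<^sub>v d \<longrightarrow> x \<bullet> (M *\<^sub>v x) > 0)"

definition interior_pt :: "nat \<Rightarrow> real vec set \<Rightarrow> real vec \<Rightarrow> bool" where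
  "interior_pt d S x \<longleftrightarrow> x \<in> carrier_vec d \<and>
     (\<exists>e>0. \<forall>z \<in> carrier_vec d. vnorm (z - x) < e \<longrightarrow> z \<in> S)"

definition ctrb_mat :: "nat \<Rightarrow> nat \<Rightarrow> real mat \<Rightarrow> real mat \<Rightarrow> real mat" where
  "ctrb_mat n m A B = mat n (n * m) (\<lambda>(r, c). (A ^\<^sub>m (c div m) * B) $$ (r, c mod m))"

definition obsv_mat :: "nat \<Rightarrow> nat \<Rightarrow> nat \<Rightarrow> real mat \<Rightarrow> real mat \<Rightarrow> real mat" where
  "obsv_mat n p l A C = mat (p * l) n (\<lambda>(r, c). (C * A ^\<^sub>m (r div p)) $$ (r mod p, c))"

definition controllable :: "nat \<Rightarrow> nat \<Rightarrow> real mat \<Rightarrow> real mat \<Rightarrow> bool" where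
  "controllable n m A B \<longleftrightarrow> mrank (ctrb_mat n m A B) = n"

definition observable :: "nat \<Rightarrow> nat \<Rightarrow> real mat \<Rightarrow> real mat \<Rightarrow> bool" where
  "observable n p A C \<longleftrightarrow> mrank (obsv_mat n p n A C) = n"

definition lag :: "nat \<Rightarrow> nat \<Rightarrow> real mat \<Rightarrow> real mat \<Rightarrow> nat" where
  "lag n p A C = (LEAST l. 1 \<le> l \<and> l \<le> n \<and> mrank (obsv_mat n p l A C) = n)"

definition is_traj :: "nat \<Rightarrow> nat \<Rightarrow> real mat \<Rightarrow> real mat \<Rightarrow> real mat \<Rightarrow> real mat \<Rightarrow>
    nat \<Rightarrow> (nat \<Rightarrow> real vec) \<Rightarrow> (nat \<Rightarrow> real vec) \<Rightarrow> bool" where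
  "is_traj n m A B C D N u y \<longleftrightarrow>
     (\<exists>x. x 0 \<in> carrier_vec n \<and>
        (\<forall>k<N. u k \<in> carrier_vec m \<and> x (Suc k) = A *\<^sub>v x k + B *\<^sub>v u k \<and>
               y k = C *\<^sub>v x k + D *\<^sub>v u k))"

definition is_traj_inf :: "nat \<Rightarrow> nat \<Rightarrow> real mat \<Rightarrow> real mat \<Rightarrow> real mat \<Rightarrow> real mat \<Rightarrow>
    (nat \<Rightarrow> real vec) \<Rightarrow> (nat \<Rightarrow> real vec) \<Rightarrow> bool" where
  "is_traj_inf n m A B C D u y \<longleftrightarrow>
     (\<exists>x. x 0 \<in> carrier_vec n \<and>
        (\<forall>k. u k \<in> carrier_vec m \<and> x (Suc k) = A *\<^sub>v x k + B *\<^sub>v u k \<and>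
               y k = C *\<^sub>v x k + D *\<^sub>v u k))"

definition equilibrium :: "nat \<Rightarrow> nat \<Rightarrow> nat \<Rightarrow> real mat \<Rightarrow> real mat \<Rightarrow> real mat \<Rightarrow> real mat \<Rightarrow>
    real vec \<Rightarrow> real vec \<Rightarrow> bool" where
  "equilibrium n m p A B C D us ys \<longleftrightarrow> us \<in> carrier_vec m \<and> ys \<in> carrier_vec p \<and>
     is_traj n m A B C D (Suc (lag n p A C)) (\<lambda>_. us) (\<lambda>_. ys)"

definition stack :: "nat \<Rightarrow> nat \<Rightarrow> (nat \<Rightarrow> real vec) \<Rightarrow> real vec" where
  "stack q d w = vec (q * d) (\<lambda>r. w (r div q) $ (r mod q))"

definition hankel :: "nat \<Rightarrow> nat \<Rightarrow> nat \<Rightarrow> (nat \<Rightarrow> real vec) \<Rightarrow> real mat" where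
  "hankel q d N w = mat (q * d) (N - d + 1) (\<lambda>(r, c). w (r div q + c) $ (r mod q))"

definition pers_exc :: "nat \<Rightarrow> nat \<Rightarrow> nat \<Rightarrow> (nat \<Rightarrow> real vec) \<Rightarrow> bool" where
  "pers_exc q d N w \<longleftrightarrow> mrank (hankel q d N w) = q * d"

definition ext_state :: "nat \<Rightarrow> nat \<Rightarrow> nat \<Rightarrow> (nat \<Rightarrow> real vec) \<Rightarrow> (nat \<Rightarrow> real vec) \<Rightarrow> nat \<Rightarrow> real vec" where
  "ext_state m p l u y t = stack m l (\<lambda>j. u (t + j)) @\<^sub>v stack p l (\<lambda>j. y (t + j))"

definition ublock :: "nat \<Rightarrow> nat \<Rightarrow> real vec \<Rightarrow> nat \<Rightarrow> real vec" where
  "ublock m p xi j = vec m (\<lambda>a. xi $ (j * m + a))"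

definition yblock :: "nat \<Rightarrow> nat \<Rightarrow> nat \<Rightarrow> real vec \<Rightarrow> nat \<Rightarrow> real vec" where
  "yblock m p l xi j = vec p (\<lambda>b. xi $ (m * l + j * p + b))"

definition prod_constr :: "nat \<Rightarrow> nat \<Rightarrow> nat \<Rightarrow> real vec set \<Rightarrow> real vec set \<Rightarrow> real vec set" where
  "prod_constr m p l U Y = {xi \<in> carrier_vec ((m + p) * l).
      (\<forall>j<l. ublock m p xi j \<in> U \<and> yblock m p l xi j \<in> Y)}"

(* extended dynamics matrices; G i, F i for i = 1..l *)
definition Ct :: "nat \<Rightarrow> nat \<Rightarrow> nat \<Rightarrow> (nat \<Rightarrow> real mat) \<Rightarrow> (nat \<Rightarrow> real mat) \<Rightarrow> real mat" where
  "Ct m p l G F = mat p ((m + p) * l) (\<lambda>(b, c).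
      if c < m * l then G (l - c div m) $$ (b, c mod m)
      else F (l - (c - m * l) div p) $$ (b, (c - m * l) mod p))"

definition At :: "nat \<Rightarrow> nat \<Rightarrow> nat \<Rightarrow> (nat \<Rightarrow> real mat) \<Rightarrow> (nat \<Rightarrow> real mat) \<Rightarrow> real mat" where
  "At m p l G F = mat ((m + p) * l) ((m + p) * l) (\<lambda>(r, c).
      if r < m * l then
        (if r div m < l - 1 \<and> c = r + m then 1 else 0)
      else if (r - m * l) div p < l - 1 then
        (if c = r + p then 1 else 0)
      else Ct m p l G F $$ ((r - m * l) mod p, c))"

definition Bt :: "nat \<Rightarrow> nat \<Rightarrow> nat \<Rightarrow> real mat \<Rightarrow> real mat" where
  "Bt m p l D = mat ((m + p) * l) m (\<lambda>(r, c).
      if r < m * l then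
        (if r div m = l - 1 \<and> c = r mod m then 1 else 0)
      else if (r - m * l) div p = l - 1 then D $$ ((r - m * l) mod p, c)
      else 0)"

(* ---- the data-driven MPC optimal control problem ----
   A candidate solution is (alpha, ub, yb) where ub j, yb j (j < L + l) stand for
   \<bar>u_(j-l)(t), \<bar>y_(j-l)(t), i.e. index j corresponds to prediction time j - l. *)
definition ocp_feasible_sol ::
  "nat \<Rightarrow> nat \<Rightarrow> nat \<Rightarrow> nat \<Rightarrow> nat \<Rightarrow> (nat \<Rightarrow> real vec) \<Rightarrow> (nat \<Rightarrow> real vec) \<Rightarrow>
   real vec set \<Rightarrow> real vec set \<Rightarrow> real vec set \<Rightarrow> real vec \<Rightarrow>
   real vec \<Rightarrow> (nat \<Rightarrow> real vec) \<Rightarrow> (nat \<Rightarrow> real vec) \<Rightarrow> bool" where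
  "ocp_feasible_sol m p l L N ud yd U Y Xf xi alpha ub yb \<longleftrightarrow>
     alpha \<in> carrier_vec (N - (L + l) + 1) \<and>
     (\<forall>j < L + l. ub j \<in> carrier_vec m \<and> yb j \<in> carrier_vec p) \<and>
     stack m (L + l) ub = hankel m (L + l) N ud *\<^sub>v alpha \<and>
     stack p (L + l) yb = hankel p (L + l) N yd *\<^sub>v alpha \<and>
     ext_state m p l ub yb 0 = xi \<and>
     ext_state m p l ub yb L \<in> Xf \<and>
     (\<forall>k<L. ub (l + k) \<in> U \<and> yb (l + k) \<in> Y)"

definition ocp_cost ::
  "nat \<Rightarrow> nat \<Rightarrow> nat \<Rightarrow> nat \<Rightarrow> real mat \<Rightarrow> real mat \<Rightarrow> real mat \<Rightarrow>
   real vec \<Rightarrow> real vec \<Rightarrow> real vec \<Rightarrow>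
   (nat \<Rightarrow> real vec) \<Rightarrow> (nat \<Rightarrow> real vec) \<Rightarrow> real" where
  "ocp_cost m p l L Q R P us ys xis ub yb =
     (\<Sum>k<L. qf R (ub (l + k) - us) + qf Q (yb (l + k) - ys)) +
     qf P (ext_state m p l ub yb L - xis)"

definition ocp_feasible ::
  "nat \<Rightarrow> nat \<Rightarrow> nat \<Rightarrow> nat \<Rightarrow> nat \<Rightarrow> (nat \<Rightarrow> real vec) \<Rightarrow> (nat \<Rightarrow> real vec) \<Rightarrow>
   real vec set \<Rightarrow> real vec set \<Rightarrow> real vec set \<Rightarrow> real vec \<Rightarrow> bool" where
  "ocp_feasible m p l L N ud yd U Y Xf xi \<longleftrightarrow>
     (\<exists>alpha ub yb. ocp_feasible_sol m p l L N ud yd U Y Xf xi alpha ub yb)"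

definition ocp_value ::
  "nat \<Rightarrow> nat \<Rightarrow> nat \<Rightarrow> nat \<Rightarrow> nat \<Rightarrow> (nat \<Rightarrow> real vec) \<Rightarrow> (nat \<Rightarrow> real vec) \<Rightarrow>
   real vec set \<Rightarrow> real vec set \<Rightarrow> real vec set \<Rightarrow>
   real mat \<Rightarrow> real mat \<Rightarrow> real mat \<Rightarrow> real vec \<Rightarrow> real vec \<Rightarrow> real vec \<Rightarrow> real vec \<Rightarrow> real" where
  "ocp_value m p l L N ud yd U Y Xf Q R P us ys xis xi =
     Inf {ocp_cost m p l L Q R P us ys xis ub yb | alpha ub yb.
            ocp_feasible_sol m p l L N ud yd U Y Xf xi alpha ub yb}"

definition ocp_optimal_sol ::
  "nat \<Rightarrow> nat \<Rightarrow> nat \<Rightarrow> nat \<Rightarrow> nat \<Rightarrow> (nat \<Rightarrow> real vec) \<Rightarrow> (nat \<Rightarrow> real vec) \<Rightarrow>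
   real vec set \<Rightarrow> real vec set \<Rightarrow> real vec set \<Rightarrow>
   real mat \<Rightarrow> real mat \<Rightarrow> real mat \<Rightarrow> real vec \<Rightarrow> real vec \<Rightarrow> real vec \<Rightarrow> real vec \<Rightarrow>
   real vec \<Rightarrow> (nat \<Rightarrow> real vec) \<Rightarrow> (nat \<Rightarrow> real vec) \<Rightarrow> bool" where
  "ocp_optimal_sol m p l L N ud yd U Y Xf Q R P us ys xis xi alpha ub yb \<longleftrightarrow>
     ocp_feasible_sol m p l L N ud yd U Y Xf xi alpha ub yb \<and>
     (\<forall>alpha' ub' yb'. ocp_feasible_sol m p l L N ud yd U Y Xf xi alpha' ub' yb' \<longrightarrow>
        ocp_cost m p l L Q R P us ys xis ub yb \<le> ocp_cost m p l L Q R P us ys xis ub' yb')"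

end

theory Submission
  imports Defs
begin

text \<open>By Willems' fundamental lemma the Hankel constraint describes exactly the trajectories of length
  \<open>L + l\<close>. Hence the optimal prediction, shifted by one step and prolonged by the terminal controller,
  is feasible at the next time, and \<open>V\<^sub>t = J\<^sub>L\<^sup>*(\<xi>\<^sub>t)\<close> decreases by at least the stage cost.
  The stage cost bounds only the newest input-output pair of the extended state, so \<open>V\<^sub>t\<close> alone is
  not a strict Lyapunov function; adding a small multiple of the sum of the squared deviations of the
  last \<open>l\<close> pairs, weighted increasingly from the oldest to the newest, makes it one.\<close>

section \<open>Linear algebra\<close>

text \<open>The fundamental lemma is proved in dual form: the matrix that stacks the recorded states
  on the input Hankel matrix is onto because its left kernel is trivial, and this is where
  controllability and persistency of excitation enter. Observability turns a constant input-output
  pair into a constant internal state; this makes \<open>xis\<close> a fixed point of the extended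
  dynamics, so that the terminal condition can be read in deviations from \<open>xis\<close>.
  Prediction and plant are compared through extended states only: the last \<open>l\<close> pairs
  together with the current input determine the current output. Assumption A2 bounds the value on
  the whole feasible set, so the exponential bound holds from every feasible initial state with the
  same constants. A bookkeeping obstacle is the column count \<open>N - d + 1\<close> with truncated
  subtraction: a Hankel matrix speaks about recorded data only if \<open>d \<le> N\<close>, and this
  has to be derived from the rank condition.\<close>

lemma nonsingular_obtain_solution:
  fixes M :: "real mat"
  assumes M: "M \<in> carrier_mat d d"
    and ker: "\<And>v. v \<in> carrier_vec d \<Longrightarrow> M *\<^sub>v v = 0\<^sub>v d \<Longrightarrow> v = 0\<^sub>v d"
    and b: "b \<in> carrier_vec d"
  obtains x where "x \<in> carrier_vec d" "M *\<^sub>v x = b"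
proof -
  have "det M \<noteq> 0"
    using ker det_0_iff_vec_prod_zero_field[OF M] by blast
  from det_non_zero_imp_unit[OF M this, of "()"]
  obtain W where W: "W \<in> carrier_mat d d" "M * W = 1\<^sub>m d"
    unfolding Units_def ring_mat_def by auto
  have "M *\<^sub>v (W *\<^sub>v b) = b"
    using M W b by (metis assoc_mult_mat_vec one_mult_mat_vec)
  then show ?thesis using that[of "W *\<^sub>v b"] W b by auto
qed

lemma scalar_prod_self_nonneg: "0 \<le> (x :: real vec) \<bullet> x"
  by (auto simp: scalar_prod_def intro: sum_nonneg)

lemma scalar_prod_self_eq_0:
  fixes x :: "real vec"
  assumes "x \<in> carrier_vec d" "x \<bullet> x = 0"
  shows "x = 0\<^sub>v d"
proof (rule eq_vecI)
  fix i assume "i < dim_vec (0\<^sub>v d :: real vec)"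
  then have i: "i < d" by simp
  have "(\<Sum>j<d. x $ j * x $ j) = 0"
    using assms by (simp add: scalar_prod_def atLeast0LessThan)
  then have "x $ i * x $ i = 0"
    using i by (subst (asm) sum_nonneg_eq_0_iff) auto
  then show "x $ i = 0\<^sub>v d $ i" using i by simp
qed (use assms in auto)

text \<open>The Gram matrix of the rows is nonsingular, since v . (M M^T v) is the squared norm of
  M^T v. Solving with it yields a solution in the row space of \<open>M\<close>.\<close>

lemma left_kernel_trivial_imp_surj:
  fixes M :: "real mat"
  assumes M: "M \<in> carrier_mat r c"
    and ker: "\<And>v. v \<in> carrier_vec r \<Longrightarrow> M\<^sup>T *\<^sub>v v = 0\<^sub>v c \<Longrightarrow> v = 0\<^sub>v r"
    and b: "b \<in> carrier_vec r"
  obtains x where "x \<in> carrier_vec c" "M *\<^sub>v x = b"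
proof -
  have MT: "M\<^sup>T \<in> carrier_mat c r" using M by simp
  have MM: "M * M\<^sup>T \<in> carrier_mat r r" using M by simp
  have "v = 0\<^sub>v r" if v: "v \<in> carrier_vec r" and z: "(M * M\<^sup>T) *\<^sub>v v = 0\<^sub>v r" for v
  proof -
    have "(M\<^sup>T *\<^sub>v v) \<bullet> (M\<^sup>T *\<^sub>v v) = (M *\<^sub>v (M\<^sup>T *\<^sub>v v)) \<bullet> v"
      using transpose_vec_mult_scalar[OF MT v mult_mat_vec_carrier[OF MT v]] by simp
    also have "M *\<^sub>v (M\<^sup>T *\<^sub>v v) = 0\<^sub>v r"
      using z assoc_mult_mat_vec[OF M MT v] by simp
    finally have "M\<^sup>T *\<^sub>v v = 0\<^sub>v c"
      using scalar_prod_self_eq_0 mult_mat_vec_carrier[OF MT v] v by simp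
    then show ?thesis by (rule ker[OF v])
  qed
  from nonsingular_obtain_solution[OF MM this b]
  obtain w where w: "w \<in> carrier_vec r" "(M * M\<^sup>T) *\<^sub>v w = b" by blast
  then have "M *\<^sub>v (M\<^sup>T *\<^sub>v w) = b" using assoc_mult_mat_vec[OF M MT w(1)] by simp
  then show ?thesis using that[of "M\<^sup>T *\<^sub>v w"] mult_mat_vec_carrier[OF MT w(1)] by blast
qed

lemma obtain_max_indpt_cols:
  fixes M :: "real mat"
  assumes M: "M \<in> carrier_mat r c"
  obtains S where "S \<subseteq> set (cols M)" "\<not> module.lin_dep class_ring (module_vec TYPE(real) r) S"
    "mrank M = card S"
proof -
  interpret vec_space "TYPE(real)" r .
  obtain S where "maximal S (\<lambda>T. T \<subseteq> set (cols M) \<and> lin_indpt T)"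
    using maximal_exists[of "(\<lambda>T. T \<subseteq> set (cols M) \<and> lin_indpt T)" "card (set (cols M))" "{}"]
    by (meson List.finite_set card_mono empty_iff empty_subsetI finite_lin_indpt2 rev_finite_subset)
  with rank_card_indpt[OF M this] M show ?thesis
    by (intro that[of S]) (auto simp: maximal_def mrank_def)
qed

lemma mrank_le_dim_col: "M \<in> carrier_mat r c \<Longrightarrow> mrank M \<le> c"
  unfolding mrank_def using vec_space.rank_le_nc[of M r c] by auto

text \<open>Full row rank supplies \<open>r\<close> independent columns; they form an invertible
  square matrix whose transpose annihilates \<open>v\<close>.\<close>

lemma full_row_rank_left_kernel:
  assumes M: "M \<in> carrier_mat r c" and rk: "mrank M = r"
    and v: "v \<in> carrier_vec r" and orth: "\<And>j. j < c \<Longrightarrow> v \<bullet> col M j = 0"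
  shows "v = 0\<^sub>v r"
proof -
  interpret vec_space "TYPE(real)" r .
  obtain S where S: "S \<subseteq> set (cols M)" "lin_indpt S" "card S = r"
    using obtain_max_indpt_cols[OF M] rk by metis
  have "finite S" using S(1) finite_subset by blast
  then obtain ss where ss: "set ss = S" "distinct ss"
    using finite_distinct_list by blast
  have len: "length ss = r" using ss S(3) distinct_card by fastforce
  have carr: "set ss \<subseteq> carrier_vec r" using ss S(1) cols_dim[of M] M by auto
  let ?W = "mat_of_cols r ss"
  have W: "?W \<in> carrier_mat r r" using len by auto
  have cW: "cols ?W = ss" using carr by (simp add: cols_mat_of_cols)
  have "rank ?W = r" using lin_indpt_full_rank[OF W] cW ss S(2) by simp
  then have "det ?W \<noteq> 0" using det_rank_iff[OF W] by simp
  then have dT: "det ?W\<^sup>T \<noteq> 0" using det_transpose[OF W] by simp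
  have "?W\<^sup>T *\<^sub>v v = 0\<^sub>v r"
  proof (rule eq_vecI)
    fix i assume "i < dim_vec (0\<^sub>v r :: real vec)"
    then have i: "i < r" by simp
    have "ss ! i \<in> set (cols M)" using ss S(1) len i by auto
    then obtain j where j: "j < c" "ss ! i = col M j"
      using M by (auto simp: in_set_conv_nth)
    have ci: "ss ! i \<in> carrier_vec r" using carr len i by auto
    have "(?W\<^sup>T *\<^sub>v v) $ i = ss ! i \<bullet> v"
      using i W len ci by (simp add: col_mat_of_cols)
    also have "\<dots> = 0" using orth[OF j(1)] j(2) v ci by (metis comm_scalar_prod)
    finally show "(?W\<^sup>T *\<^sub>v v) $ i = 0\<^sub>v r $ i" using i by simp
  qed (use W len in auto)
  then show ?thesis
    using dT det_0_iff_vec_prod_zero_field[of "?W\<^sup>T" r] W v by auto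
qed

lemma full_col_rank_inj:
  assumes M: "M \<in> carrier_mat r c" and rk: "mrank M = c"
    and v: "v \<in> carrier_vec c" and z: "M *\<^sub>v v = 0\<^sub>v r"
  shows "v = 0\<^sub>v c"
proof -
  interpret vec_space "TYPE(real)" r .
  obtain S where S: "S \<subseteq> set (cols M)" "lin_indpt S" "card S = c"
    using obtain_max_indpt_cols[OF M] rk by metis
  have len: "length (cols M) = c" using M by simp
  \<comment> \<open>\<open>S\<close> is a set, so equal columns would collapse in it. Cardinality
    \<open>c\<close> therefore forces the columns to be distinct and \<open>S\<close> to contain all
    of them, and a nonzero kernel vector would be a dependence of \<open>S\<close>.\<close>
  have "card S \<le> card (set (cols M))" using S(1) by (simp add: card_mono)
  moreover have "card (set (cols M)) \<le> c" using len card_length by metis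
  ultimately have "card (set (cols M)) = length (cols M)" "card S = card (set (cols M))"
    using S(3) len by auto
  then have "distinct (cols M)" "S = set (cols M)"
    using card_distinct[of "cols M"] card_subset_eq[OF List.finite_set S(1)] by auto
  then show ?thesis using lin_depI[OF M v _ z] S(2) by blast
qed

text \<open>A zero row appended to the matrix makes it square. The unit vector of that row lies in
  the kernel of the transpose, so the determinant vanishes and the square matrix has a kernel
  vector.\<close>

lemma wide_mat_kernel_nontrivial:
  fixes M :: "real mat"
  assumes M: "M \<in> carrier_mat d (Suc d)"
  obtains v where "v \<in> carrier_vec (Suc d)" "v \<noteq> 0\<^sub>v (Suc d)" "M *\<^sub>v v = 0\<^sub>v d"
proof -
  let ?Z = "0\<^sub>m 1 (Suc d) :: real mat"
  have W: "M @\<^sub>r ?Z \<in> carrier_mat (Suc d) (Suc d)"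
    using carrier_append_rows[OF M, of ?Z 1] by simp
  have "(M @\<^sub>r ?Z)\<^sup>T *\<^sub>v unit_vec (Suc d) d = 0\<^sub>v (Suc d)"
    using M W by (intro eq_vecI) (auto simp: append_rows_def)
  moreover have "unit_vec (Suc d) d \<noteq> (0\<^sub>v (Suc d) :: real vec)"
    by (metis index_unit_vec(1) index_zero_vec(1) lessI zero_neq_one)
  ultimately have "det (M @\<^sub>r ?Z)\<^sup>T = 0"
    using det_0_iff_vec_prod_zero_field[of "(M @\<^sub>r ?Z)\<^sup>T" "Suc d"] W
    by (metis transpose_carrier_mat unit_vec_carrier)
  then have "det (M @\<^sub>r ?Z) = 0"
    using det_transpose[OF W] by simp
  then obtain v where v: "v \<in> carrier_vec (Suc d)" "v \<noteq> 0\<^sub>v (Suc d)" 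
      "(M @\<^sub>r ?Z) *\<^sub>v v = 0\<^sub>v (Suc d)"
    using det_0_iff_vec_prod_zero_field[OF W] by blast
  have e: "(M *\<^sub>v v) @\<^sub>v (?Z *\<^sub>v v) = 0\<^sub>v (Suc d)"
    using mat_mult_append[OF M, of ?Z 1 v] v by simp
  have "M *\<^sub>v v = 0\<^sub>v d"
  proof (rule eq_vecI)
    fix i assume i: "i < dim_vec (0\<^sub>v d :: real vec)"
    have "((M *\<^sub>v v) @\<^sub>v (?Z *\<^sub>v v)) $ i = (M *\<^sub>v v) $ i" using i M by simp
    then show "(M *\<^sub>v v) $ i = 0\<^sub>v d $ i" using e i by simp
  qed (use M in auto)
  then show ?thesis using that v by blast
qed

text \<open>This replaces the Cayley-Hamilton theorem: only the orbit of one vector has to be annihilated.\<close>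
lemma krylov_monic_relation:
  fixes w :: "nat \<Rightarrow> real vec"
  assumes w: "\<And>j. w j \<in> carrier_vec n" and step: "\<And>j. w (Suc j) = M *\<^sub>v w j"
    and M: "M \<in> carrier_mat n n"
  obtains a :: "nat \<Rightarrow> real" where "a n = 1"
    "\<And>i. i < n \<Longrightarrow> (\<Sum>j\<le>n. a j * w j $ i) = 0"
proof -
  let ?W = "mat n (Suc n) (\<lambda>(i, j). w j $ i)"
  obtain v where v: "v \<in> carrier_vec (Suc n)" "v \<noteq> 0\<^sub>v (Suc n)" "?W *\<^sub>v v = 0\<^sub>v n"
    using wide_mat_kernel_nontrivial[of ?W n] by auto
  let ?S = "{j. j \<le> n \<and> v $ j \<noteq> 0}"
  have "?S \<noteq> {}"
  proof
    assume "?S = {}"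
    then have "v = 0\<^sub>v (Suc n)" using v(1) by (intro eq_vecI) auto
    then show False using v(2) by simp
  qed
  \<comment> \<open>The last nonzero coefficient: division by it gives a monic relation of degree
    \<open>r\<close>, which may be smaller than \<open>n\<close>.\<close>
  define r where "r = Max ?S"
  have r: "r \<in> ?S" using Max_in[OF _ \<open>?S \<noteq> {}\<close>] unfolding r_def by simp
  have above: "v $ j = 0" if "r < j" "j \<le> n" for j
    using that Max_ge[of ?S j] unfolding r_def by fastforce
  define b where "b = (\<lambda>j. v $ j / v $ r)"
  have rel0: "(\<Sum>j\<le>r. b j * w j $ i) = 0" if i: "i < n" for i
  proof -
    have "0 = (?W *\<^sub>v v) $ i" using v(3) i by simp
    also have "\<dots> = (\<Sum>j\<le>n. v $ j * w j $ i)"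
      using i v(1) by (simp add: scalar_prod_def atLeast0LessThan lessThan_Suc_atMost mult.commute)
    also have "\<dots> = (\<Sum>j\<le>r. v $ j * w j $ i)"
      using r above by (intro sum.mono_neutral_right) auto
    finally have "(\<Sum>j\<le>r. v $ j * w j $ i) / v $ r = 0" by simp
    then show ?thesis by (simp add: b_def sum_divide_distrib)
  qed
  have rel: "(\<Sum>j\<le>r. b j * w (j + s) $ i) = 0" if i: "i < n" for i s
    using i
  proof (induction s arbitrary: i)
    case 0
    then show ?case using rel0 by simp
  next
    case (Suc s)
    have "w (j + Suc s) $ i = (\<Sum>k<n. M $$ (i, k) * w (j + s) $ k)" for j
      using step[of "j + s"] Suc.prems M w[of "j + s"]
      by (simp add: scalar_prod_def atLeast0LessThan)
    then have "(\<Sum>j\<le>r. b j * w (j + Suc s) $ i)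
        = (\<Sum>j\<le>r. \<Sum>k<n. M $$ (i, k) * (b j * w (j + s) $ k))"
      by (simp add: sum_distrib_left algebra_simps)
    also have "\<dots> = (\<Sum>k<n. M $$ (i, k) * (\<Sum>j\<le>r. b j * w (j + s) $ k))"
      by (subst sum.swap) (simp add: sum_distrib_left)
    also have "\<dots> = 0" using Suc.IH by simp
    finally show ?case .
  qed
  \<comment> \<open>Linearity moves the relation along the orbit, so it may be shifted by
    \<open>n - r\<close> to put the leading coefficient 1 exactly at index \<open>n\<close>.\<close>
  define a where "a = (\<lambda>j. if j < n - r then 0 else b (j - (n - r)))"
  have "a n = 1" using r by (simp add: a_def b_def)
  moreover have "(\<Sum>j\<le>n. a j * w j $ i) = 0" if "i < n" for i
  proof -
    have "(\<Sum>j\<le>n. a j * w j $ i) = (\<Sum>j\<in>{n - r..n}. a j * w j $ i)"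
      by (intro sum.mono_neutral_right) (auto simp: a_def)
    also have "\<dots> = (\<Sum>j\<le>r. b j * w (j + (n - r)) $ i)"
      using r by (intro sum.reindex_bij_witness[of _ "\<lambda>j. j + (n - r)" "\<lambda>j. j - (n - r)"])
        (auto simp: a_def)
    finally show ?thesis using rel that by simp
  qed
  ultimately show ?thesis using that by blast
qed

section \<open>Positive definite quadratic forms\<close>

lemma qf_nonneg:
  assumes "pos_def d M" "x \<in> carrier_vec d"
  shows "0 \<le> qf M x"
  using assms by (cases "x = 0\<^sub>v d") (auto simp: pos_def_def qf_def intro: less_imp_le)

lemma pos_def_Cauchy_Schwarz:
  assumes M: "pos_def d M" and x: "x \<in> carrier_vec d" and z: "z \<in> carrier_vec d"
  shows "(x \<bullet> (M *\<^sub>v z))\<^sup>2 \<le> qf M x * qf M z"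
proof (cases "z = 0\<^sub>v d")
  case True
  have "M *\<^sub>v z = 0\<^sub>v d"
    using M True by (auto simp: pos_def_def)
  then have "x \<bullet> (M *\<^sub>v z) = 0" using x by simp
  then show ?thesis using True M x z qf_nonneg[OF M] by (auto intro: mult_nonneg_nonneg)
next
  case False
  have Mc: "M \<in> carrier_mat d d" and sym: "M\<^sup>T = M" using M by (auto simp: pos_def_def)
  have qz: "qf M z > 0" using M z False by (auto simp: pos_def_def qf_def)
  \<comment> \<open>The minimiser of the form along x - t z; nonnegativity of the minimum is the
    claim.\<close>
  define t where "t = x \<bullet> (M *\<^sub>v z) / qf M z"
  have c: "M *\<^sub>v x \<in> carrier_vec d" "M *\<^sub>v z \<in> carrier_vec d" using Mc x z by auto
  have swap: "z \<bullet> (M *\<^sub>v x) = x \<bullet> (M *\<^sub>v z)"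
    using transpose_vec_mult_scalar[OF Mc x z] sym c(2) x by (metis comm_scalar_prod)
  have e: "M *\<^sub>v (x - t \<cdot>\<^sub>v z) = M *\<^sub>v x - t \<cdot>\<^sub>v (M *\<^sub>v z)"
    using Mc x z by (simp add: mult_minus_distrib_mat_vec mult_mat_vec)
  have "0 \<le> qf M (x - t \<cdot>\<^sub>v z)" using qf_nonneg[OF M] x z by simp
  also have "\<dots> = (x - t \<cdot>\<^sub>v z) \<bullet> (M *\<^sub>v x - t \<cdot>\<^sub>v (M *\<^sub>v z))"
    by (simp add: qf_def e)
  also have "\<dots> = qf M x - 2 * t * (x \<bullet> (M *\<^sub>v z)) + t\<^sup>2 * qf M z"
    using x z c swap
    by (simp add: minus_scalar_prod_distrib[of _ d] scalar_prod_minus_distrib[of _ d] qf_def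
        algebra_simps power2_eq_square)
  also have "\<dots> = qf M x - (x \<bullet> (M *\<^sub>v z))\<^sup>2 / qf M z"
    using qz by (simp add: t_def field_simps power2_eq_square)
  finally show ?thesis using qz by (simp add: field_simps)
qed

text \<open>An elementary substitute for the smallest eigenvalue. With M w_i = e_i the entry x_i
  equals x . (M w_i), and Cauchy-Schwarz bounds its square by \<open>qf M x * qf M (w i)\<close>;
  summation over the entries bounds x . x.\<close>

lemma pos_def_lower_bound:
  assumes M: "pos_def d M"
  obtains c where "c > 0" "\<And>x. x \<in> carrier_vec d \<Longrightarrow> c * (x \<bullet> x) \<le> qf M x"
proof -
  have Mc: "M \<in> carrier_mat d d" using M by (auto simp: pos_def_def)
  have ker: "v = 0\<^sub>v d" if "v \<in> carrier_vec d" "M *\<^sub>v v = 0\<^sub>v d" for v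
    using M that unfolding pos_def_def by fastforce
  have "\<exists>w. w \<in> carrier_vec d \<and> M *\<^sub>v w = unit_vec d i" for i
    using nonsingular_obtain_solution[OF Mc ker, of "unit_vec d i"] by auto
  then obtain w where w: "\<And>i. w i \<in> carrier_vec d" "\<And>i. M *\<^sub>v w i = unit_vec d i" by metis
  \<comment> \<open>The sum is the trace of the inverse of \<open>M\<close>; the summand 1 keeps
    \<open>s\<close> positive when \<open>d = 0\<close>.\<close>
  define s where "s = 1 + (\<Sum>i<d. qf M (w i))"
  have s: "s > 0" unfolding s_def using qf_nonneg[OF M w(1)] by (simp add: add_pos_nonneg sum_nonneg)
  have "1 / s * (x \<bullet> x) \<le> qf M x" if x: "x \<in> carrier_vec d" for x
  proof -
    have "(x $ i)\<^sup>2 \<le> qf M x * qf M (w i)" if "i < d" for i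
      using pos_def_Cauchy_Schwarz[OF M x w(1), of i] w(2) x that by simp
    then have "(\<Sum>i<d. (x $ i)\<^sup>2) \<le> (\<Sum>i<d. qf M x * qf M (w i))" by (intro sum_mono) auto
    then have "x \<bullet> x \<le> qf M x * (\<Sum>i<d. qf M (w i))"
      using x by (simp add: scalar_prod_def atLeast0LessThan power2_eq_square sum_distrib_left)
    also have "\<dots> \<le> qf M x * s" using qf_nonneg[OF M x] by (simp add: s_def mult_left_mono)
    finally show ?thesis using s by (simp add: field_simps)
  qed
  then show ?thesis using that[of "1 / s"] s by simp
qed

section \<open>Willems' fundamental lemma\<close>

lemma block_index_less:
  fixes i j q d :: nat
  assumes "j < d" "i < q"
  shows "j * q + i < q * d"
proof -
  have "j * q + i < Suc j * q" using assms(2) by simp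
  also have "\<dots> \<le> d * q" using assms(1) by (intro mult_le_mono1) simp
  finally show ?thesis by (simp add: mult.commute)
qed

lemma block_index_cases:
  fixes r q d :: nat
  assumes "r < q * d"
  obtains i j where "j < d" "i < q" "r = j * q + i"
proof -
  have "q > 0" using assms by (cases q) auto
  moreover have "r div q < d" using assms by (simp add: less_mult_imp_div_less mult.commute)
  ultimately show ?thesis using that[of "r div q" "r mod q"] by simp
qed

lemma stack_carrier [simp]: "stack q d w \<in> carrier_vec (q * d)"
  by (simp add: stack_def)

lemma dim_stack [simp]: "dim_vec (stack q d w) = q * d"
  by (simp add: stack_def)

lemma stack_index:
  assumes "j < d" "i < q"
  shows "stack q d w $ (j * q + i) = w j $ i"
  using block_index_less[OF assms] assms by (simp add: stack_def)

lemma stack_eq_iff: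
  assumes v: "v \<in> carrier_vec (q * d)"
  shows "stack q d w = v \<longleftrightarrow> (\<forall>j<d. \<forall>i<q. w j $ i = v $ (j * q + i))"
proof
  assume e: "\<forall>j<d. \<forall>i<q. w j $ i = v $ (j * q + i)"
  show "stack q d w = v"
  proof (rule eq_vecI)
    fix r assume "r < dim_vec v"
    then have "r < q * d" using v by simp
    then obtain i j where "j < d" "i < q" "r = j * q + i" by (rule block_index_cases)
    then show "stack q d w $ r = v $ r" using e by (simp add: stack_index)
  qed (use v in simp)
qed (auto simp: stack_index)

lemma scalar_prod_stack:
  assumes "\<And>j. j < d \<Longrightarrow> v j \<in> carrier_vec q"
  shows "stack q d w \<bullet> stack q d v = (\<Sum>j<d. w j \<bullet> v j)"
proof -
  let ?f = "\<lambda>r. stack q d w $ r * stack q d v $ r"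
  have "sum ?f {j * q..<j * q + q} = w j \<bullet> v j" if j: "j < d" for j
  proof -
    have "sum ?f {j * q..<j * q + q} = (\<Sum>i<q. ?f (j * q + i))"
      using sum.shift_bounds_nat_ivl[of ?f 0 "j * q" q] by (simp add: add.commute atLeast0LessThan)
    then show ?thesis
      using assms[OF j] j by (simp add: stack_index scalar_prod_def atLeast0LessThan)
  qed
  then show ?thesis
    using sum.nat_group[of ?f q d] by (simp add: scalar_prod_def atLeast0LessThan mult.commute)
qed

text \<open>Block row \<open>j\<close> of a Hankel matrix with \<open>M\<close> columns. It turns
  the stacked Hankel constraint into one vector equation per time step, and the same notation covers
  the windows of the internal state.\<close>

definition window_mat :: "nat \<Rightarrow> nat \<Rightarrow> (nat \<Rightarrow> real vec) \<Rightarrow> nat \<Rightarrow> real mat" where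
  "window_mat q M w j = mat q M (\<lambda>(i, c). w (j + c) $ i)"

lemma window_mat_carrier [simp]: "window_mat q M w j \<in> carrier_mat q M"
  by (simp add: window_mat_def)

lemma window_mat_mult_carrier [simp]: "window_mat q M w j *\<^sub>v v \<in> carrier_vec q"
  by (rule carrier_vecI) (simp add: window_mat_def)

lemma col_window_mat:
  "c < M \<Longrightarrow> w (j + c) \<in> carrier_vec q \<Longrightarrow> col (window_mat q M w j) c = w (j + c)"
  by (intro eq_vecI) (simp_all add: window_mat_def)

lemma hankel_carrier [simp]: "hankel q d N w \<in> carrier_mat (q * d) (N - d + 1)"
  by (simp add: hankel_def)

lemma row_hankel:
  assumes "j < d" "i < q"
  shows "row (hankel q d N w) (j * q + i) = row (window_mat q (N - d + 1) w j) i"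
  using block_index_less[OF assms] assms
  by (intro eq_vecI) (auto simp: hankel_def window_mat_def)

lemma col_hankel:
  assumes "c < N - d + 1"
  shows "col (hankel q d N w) c = stack q d (\<lambda>j. w (j + c))"
  using assms by (intro eq_vecI) (simp_all add: hankel_def stack_def)

lemma stack_eq_hankel_iff:
  assumes "\<And>j. j < d \<Longrightarrow> w j \<in> carrier_vec q"
  shows "stack q d w = hankel q d N wd *\<^sub>v alpha \<longleftrightarrow>
    (\<forall>j<d. w j = window_mat q (N - d + 1) wd j *\<^sub>v alpha)"
proof -
  have c: "hankel q d N wd *\<^sub>v alpha \<in> carrier_vec (q * d)"
    by (rule carrier_vecI) (simp add: hankel_def)
  have h: "(hankel q d N wd *\<^sub>v alpha) $ (j * q + i) = (window_mat q (N - d + 1) wd j *\<^sub>v alpha) $ i"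
    if "j < d" "i < q" for i j
    using block_index_less[OF that] that row_hankel[OF that, of N wd]
    by (simp add: carrier_matD[OF hankel_carrier] carrier_matD[OF window_mat_carrier])
  have "w j = window_mat q (N - d + 1) wd j *\<^sub>v alpha \<longleftrightarrow>
      (\<forall>i<q. w j $ i = (window_mat q (N - d + 1) wd j *\<^sub>v alpha) $ i)" if "j < d" for j
    using assms[OF that] window_mat_mult_carrier[of q "N - d + 1" wd j alpha]
    by (metis carrier_vecD eq_vecI)
  then show ?thesis unfolding stack_eq_iff[OF c] using h by auto
qed

text \<open>The recurrence holds in every column, and combining columns by \<open>alpha\<close> is
  linear. With \<open>i = Suc j\<close> it serves the state update, with \<open>i = j\<close> the
  output equation.\<close>

lemma window_mat_linear:
  assumes A: "A \<in> carrier_mat q n" and B: "B \<in> carrier_mat q m"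
    and alpha: "alpha \<in> carrier_vec M"
    and w: "\<And>c. c < M \<Longrightarrow> w (i + c) = A *\<^sub>v x (j + c) + B *\<^sub>v u (j + c)"
    and x: "\<And>c. c < M \<Longrightarrow> x (j + c) \<in> carrier_vec n"
    and u: "\<And>c. c < M \<Longrightarrow> u (j + c) \<in> carrier_vec m"
  shows "window_mat q M w i *\<^sub>v alpha
    = A *\<^sub>v (window_mat n M x j *\<^sub>v alpha) + B *\<^sub>v (window_mat m M u j *\<^sub>v alpha)"
proof -
  let ?X = "window_mat n M x j" and ?U = "window_mat m M u j"
  have XU: "?X \<in> carrier_mat n M" "?U \<in> carrier_mat m M" by simp_all
  have "window_mat q M w i = A * ?X + B * ?U"
  proof (rule eq_matI)
    fix a c assume "a < dim_row (A * ?X + B * ?U)" "c < dim_col (A * ?X + B * ?U)"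
    then have a: "a < q" and c: "c < M" using B XU by auto
    show "window_mat q M w i $$ (a, c) = (A * ?X + B * ?U) $$ (a, c)"
      using A B XU a c w[OF c] col_window_mat[OF c, of x j n] col_window_mat[OF c, of u j m] x[OF c] u[OF c]
      by (simp add: window_mat_def)
  qed (use B XU in \<open>auto simp: window_mat_def\<close>)
  then show ?thesis
    using A B XU alpha by (simp add: add_mult_distrib_mat_vec[of _ q M] assoc_mult_mat_vec[of _ q _ _ M])
qed

lemma state_carrier:
  fixes x :: "nat \<Rightarrow> real vec"
  assumes "A \<in> carrier_mat n n" "B \<in> carrier_mat n m" "x 0 \<in> carrier_vec n"
    and "\<And>k. k < N \<Longrightarrow> x (Suc k) = A *\<^sub>v x k + B *\<^sub>v u k"
    and "\<And>k. k < N \<Longrightarrow> u k \<in> carrier_vec m"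
  shows "k \<le> N \<Longrightarrow> x k \<in> carrier_vec n"
  by (induction k) (use assms in \<open>auto\<close>)

text \<open>The direct half of the fundamental lemma: the internal state of the combined trajectory
  is the same combination of the recorded states.\<close>

lemma hankel_image_is_traj:
  assumes A: "A \<in> carrier_mat n n" and B: "B \<in> carrier_mat n m"
    and C: "C \<in> carrier_mat p n" and D: "D \<in> carrier_mat p m"
    and data: "is_traj n m A B C D N ud yd" and dN: "d \<le> N"
    and alpha: "alpha \<in> carrier_vec (N - d + 1)"
    and ub: "\<And>j. j < d \<Longrightarrow> ub j = window_mat m (N - d + 1) ud j *\<^sub>v alpha"
    and yb: "\<And>j. j < d \<Longrightarrow> yb j = window_mat p (N - d + 1) yd j *\<^sub>v alpha"
  shows "is_traj n m A B C D d ub yb"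
proof -
  obtain x where x0: "x 0 \<in> carrier_vec n"
    and u: "\<And>k. k < N \<Longrightarrow> ud k \<in> carrier_vec m"
    and x: "\<And>k. k < N \<Longrightarrow> x (Suc k) = A *\<^sub>v x k + B *\<^sub>v ud k"
    and y: "\<And>k. k < N \<Longrightarrow> yd k = C *\<^sub>v x k + D *\<^sub>v ud k"
    using data unfolding is_traj_def by blast
  have xc: "x k \<in> carrier_vec n" if "k \<le> N" for k
    using state_carrier[OF A B x0 x u that] by blast
  let ?M = "N - d + 1"
  let ?x = "\<lambda>j. window_mat n ?M x j *\<^sub>v alpha"
  \<comment> \<open>\<open>d \<le> N\<close> keeps all windows inside the data; otherwise truncation
    leaves one column that reaches beyond time \<open>N - 1\<close>.\<close>
  have less: "j + c < N" if "j < d" "c < ?M" for j c using that dN by linarith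
  have "?x (Suc j) = A *\<^sub>v ?x j + B *\<^sub>v ub j" if "j < d" for j
    unfolding ub[OF that]
    by (rule window_mat_linear[OF A B alpha]) (use less[OF that] x xc u in \<open>auto simp: less_imp_le\<close>)
  moreover have "yb j = C *\<^sub>v ?x j + D *\<^sub>v ub j" if "j < d" for j
    unfolding ub[OF that] yb[OF that]
    by (rule window_mat_linear[OF C D alpha]) (use less[OF that] y xc u in \<open>auto simp: less_imp_le\<close>)
  ultimately show ?thesis
    unfolding is_traj_def using ub by (intro exI[of _ ?x]) auto
qed

text \<open>The relation is propagated along the dynamics to the shifts \<open>0, \<dots>, n\<close> and combined with the
  coefficients of a monic relation of the orbit of \<open>\<xi>\<close> under the transposed dynamics. The state drops
  out, so persistency of excitation makes every input coefficient of the combination vanish; these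
  coefficients are a triangular recursion for the sequence \<open>g\<close>, which lists the Markov parameters
  \<open>\<xi>\<^sup>T A\<^sup>i B\<close> followed by \<open>\<eta>\<close>.\<close>
lemma willems_left_kernel:
  assumes A: "A \<in> carrier_mat n n" and B: "B \<in> carrier_mat n m"
    and ctrb: "controllable n m A B"
    and pe: "pers_exc m (d + n) N u" and dN: "d + n \<le> N"
    and x: "\<And>k. k < N \<Longrightarrow> x (Suc k) = A *\<^sub>v x k + B *\<^sub>v u k"
    and xc: "\<And>k. k \<le> N \<Longrightarrow> x k \<in> carrier_vec n"
    and uc: "\<And>k. k < N \<Longrightarrow> u k \<in> carrier_vec m"
    and xi: "\<xi> \<in> carrier_vec n" and eta: "\<And>i. i < d \<Longrightarrow> \<eta> i \<in> carrier_vec m"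
    and rel: "\<And>k. k < N - d + 1 \<Longrightarrow> \<xi> \<bullet> x k + (\<Sum>i<d. \<eta> i \<bullet> u (k + i)) = 0"
  shows "\<xi> = 0\<^sub>v n" and "\<And>i. i < d \<Longrightarrow> \<eta> i = 0\<^sub>v m"
proof -
  define w where "w j = ((\<lambda>v. A\<^sup>T *\<^sub>v v) ^^ j) \<xi>" for j
  have w0: "w 0 = \<xi>" and wS: "\<And>j. w (Suc j) = A\<^sup>T *\<^sub>v w j" by (auto simp: w_def)
  have AT: "A\<^sup>T \<in> carrier_mat n n" and BT: "B\<^sup>T \<in> carrier_mat m n" using A B by auto
  have wc: "w j \<in> carrier_vec n" for j
    by (induction j) (use w0 wS xi AT in auto)
  have wA: "w (Suc j) \<bullet> v = w j \<bullet> (A *\<^sub>v v)" if "v \<in> carrier_vec n" for j v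
    using transpose_vec_mult_scalar[OF A that wc] wS by simp
  define b where "b i = B\<^sup>T *\<^sub>v w i" for i
  have bc: "b i \<in> carrier_vec m" for i using BT wc by (auto simp: b_def)
  have bB: "b j \<bullet> v = w j \<bullet> (B *\<^sub>v v)" if "v \<in> carrier_vec m" for j v
    using transpose_vec_mult_scalar[OF B that wc] by (simp add: b_def)
  \<comment> \<open>Variation of constants over \<open>j\<close> steps, tested against (A^T)^s
    \<open>\<xi>\<close>.\<close>
  have expand: "w s \<bullet> x (k + j) = w (s + j) \<bullet> x k + (\<Sum>q<j. b (s + j - 1 - q) \<bullet> u (k + q))"
    if "k + j \<le> N" for s k j
    using that
  proof (induction j arbitrary: s)
    case 0
    then show ?case by simp
  next
    case (Suc j)
    have c: "x (k + j) \<in> carrier_vec n" "u (k + j) \<in> carrier_vec m"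
      using xc uc Suc.prems by auto
    have "w s \<bullet> x (k + Suc j) = w s \<bullet> (A *\<^sub>v x (k + j)) + w s \<bullet> (B *\<^sub>v u (k + j))"
      using x[of "k + j"] Suc.prems wc c A B by (simp add: scalar_prod_add_distrib[of _ n])
    also have "\<dots> = w (Suc s) \<bullet> x (k + j) + b s \<bullet> u (k + j)"
      using wA bB c by simp
    finally show ?case using Suc.IH[of "Suc s"] Suc.prems by simp
  qed
  obtain a where an: "a n = 1" and ann: "\<And>i. i < n \<Longrightarrow> (\<Sum>j\<le>n. a j * w j $ i) = 0"
    using krylov_monic_relation[of w n "A\<^sup>T"] wc wS AT by blast
  \<comment> \<open>The order is b_(n-1), ..., b_0, \<open>\<eta>\<close> 0, ...,
    \<open>\<eta>\<close> (d-1), followed by zeros. When the relation at time \<open>k + j\<close>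
    is rewritten over the window starting at \<open>k\<close>, the coefficient of
    \<open>u (k + q)\<close> is then \<open>g (q + n - j)\<close> for every \<open>j\<close>, so all
    shifts read the same list.\<close>
  define g where "g s = (if s < n then b (n - 1 - s) else if s < n + d then \<eta> (s - n) else 0\<^sub>v m)" for s
  have gc: "g s \<in> carrier_vec m" for s using bc eta by (auto simp: g_def)
  have shifted: "w j \<bullet> x k + (\<Sum>q<d + n. g (q + n - j) \<bullet> u (k + q)) = 0"
    if k: "k < N - (d + n) + 1" and j: "j \<le> n" for k j
  proof -
    have kN: "k + d + n \<le> N" using k dN by linarith
    have "(\<Sum>q<d + n. g (q + n - j) \<bullet> u (k + q)) = (\<Sum>q<j + d. g (q + n - j) \<bullet> u (k + q))"
    proof (rule sum.mono_neutral_right)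
      show "\<forall>q\<in>{..<d + n} - {..<j + d}. g (q + n - j) \<bullet> u (k + q) = 0"
        using kN j uc by (auto simp: g_def)
    qed (use j in auto)
    also have "\<dots> = (\<Sum>q<j. g (q + n - j) \<bullet> u (k + q)) + (\<Sum>q\<in>{j..<j + d}. g (q + n - j) \<bullet> u (k + q))"
      using sum.atLeastLessThan_concat[of 0 j "j + d" "\<lambda>q. g (q + n - j) \<bullet> u (k + q)"]
      by (simp add: atLeast0LessThan)
    also have "(\<Sum>q<j. g (q + n - j) \<bullet> u (k + q)) = (\<Sum>q<j. b (j - 1 - q) \<bullet> u (k + q))"
    proof (intro sum.cong refl)
      fix q assume "q \<in> {..<j}"
      then have "q + n - j < n" "n - 1 - (q + n - j) = j - 1 - q" using j by auto
      then show "g (q + n - j) \<bullet> u (k + q) = b (j - 1 - q) \<bullet> u (k + q)" by (simp add: g_def)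
    qed
    also have "(\<Sum>q\<in>{j..<j + d}. g (q + n - j) \<bullet> u (k + q)) = (\<Sum>i<d. \<eta> i \<bullet> u (k + j + i))"
      by (rule sum.reindex_bij_witness[of _ "\<lambda>i. j + i" "\<lambda>q. q - j"])
        (use j in \<open>auto simp: g_def add.assoc\<close>)
    finally show ?thesis
      using rel[of "k + j"] expand[of k j 0] kN j w0 by (simp add: add.commute add.left_commute)
  qed
  define z where "z q = vec m (\<lambda>i. \<Sum>j\<le>n. a j * g (q + n - j) $ i)" for q
  have z_prod: "z q \<bullet> v = (\<Sum>j\<le>n. a j * (g (q + n - j) \<bullet> v))" if "v \<in> carrier_vec m" for q v
  proof -
    have "z q \<bullet> v = (\<Sum>i<m. \<Sum>j\<le>n. a j * (g (q + n - j) $ i * v $ i))"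
      using that by (simp add: z_def scalar_prod_def atLeast0LessThan sum_distrib_right mult.assoc)
    also have "\<dots> = (\<Sum>j\<le>n. \<Sum>i<m. a j * (g (q + n - j) $ i * v $ i))" by (rule sum.swap)
    finally show ?thesis
      using that by (simp add: scalar_prod_def atLeast0LessThan sum_distrib_left)
  qed
  have w_prod: "(\<Sum>j\<le>n. a j * (w j \<bullet> v)) = 0" if "v \<in> carrier_vec n" for v
  proof -
    have "(\<Sum>j\<le>n. a j * (w j \<bullet> v)) = (\<Sum>j\<le>n. \<Sum>i<n. a j * w j $ i * v $ i)"
      using that by (simp add: scalar_prod_def atLeast0LessThan sum_distrib_left mult.assoc)
    also have "\<dots> = (\<Sum>i<n. (\<Sum>j\<le>n. a j * w j $ i) * v $ i)"
      by (subst sum.swap) (simp add: sum_distrib_right)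
    finally show ?thesis using ann by simp
  qed
  have "stack m (d + n) z = 0\<^sub>v (m * (d + n))"
  proof (rule full_row_rank_left_kernel[OF hankel_carrier[of m "d + n" N u]])
    show "mrank (hankel m (d + n) N u) = m * (d + n)" using pe by (simp add: pers_exc_def)
    fix k assume k: "k < N - (d + n) + 1"
    have ukc: "u (k + q) \<in> carrier_vec m" if "q < d + n" for q using uc k dN that by simp
    have "stack m (d + n) z \<bullet> col (hankel m (d + n) N u) k = (\<Sum>q<d + n. z q \<bullet> u (k + q))"
      using ukc col_hankel[OF k, of m u] by (simp add: scalar_prod_stack add.commute)
    also have "\<dots> = (\<Sum>q<d + n. \<Sum>j\<le>n. a j * (g (q + n - j) \<bullet> u (k + q)))"
      using ukc by (intro sum.cong refl z_prod) simp
    also have "\<dots> = (\<Sum>j\<le>n. a j * (\<Sum>q<d + n. g (q + n - j) \<bullet> u (k + q)))"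
      by (subst sum.swap) (simp add: sum_distrib_left)
    also have "\<dots> = (\<Sum>j\<le>n. a j * (- (w j \<bullet> x k)))"
      using shifted[OF k] by (intro sum.cong refl arg_cong2[of _ _ _ _ "(*)"]) (auto simp: eq_neg_iff_add_eq_0 add.commute)
    also have "\<dots> = 0" using w_prod[of "x k"] xc k dN by (simp add: sum_negf)
    finally show "stack m (d + n) z \<bullet> col (hankel m (d + n) N u) k = 0" .
  qed simp
  then have z0: "z q $ i = 0" if "q < d + n" "i < m" for q i
    using stack_index[OF that, of z] block_index_less[OF that] by simp
  \<comment> \<open>Downward induction on \<open>q\<close>: since \<open>a n = 1\<close>,
    \<open>z q\<close> is \<open>g q\<close> plus a combination of entries of \<open>g\<close> with
    larger index, which vanish already; from index \<open>n + d\<close> on \<open>g\<close> is zero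
    by definition.\<close>
  have g0: "g q = 0\<^sub>v m" for q
  proof (induction "n + d - q" arbitrary: q rule: less_induct)
    case less
    show ?case
    proof (cases "q < n + d")
      case True
      show ?thesis
      proof (rule eq_vecI)
        fix i assume "i < dim_vec (0\<^sub>v m :: real vec)"
        then have i: "i < m" by simp
        have "g (q + n - j) = 0\<^sub>v m" if "j < n" for j
          by (rule less) (use that True in auto)
        then have "(\<Sum>j<n. a j * g (q + n - j) $ i) = 0" using i by simp
        moreover have "z q $ i = (\<Sum>j<n. a j * g (q + n - j) $ i) + a n * g q $ i"
          using i by (simp add: z_def lessThan_Suc_atMost[symmetric])
        ultimately show "g q $ i = 0\<^sub>v m $ i" using z0[of q i] an i True by simp
      qed (use gc in auto)
    qed (simp add: g_def)
  qed
  show "\<eta> i = 0\<^sub>v m" if "i < d" for i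
    using g0[of "n + i"] that by (simp add: g_def)
  have b0: "b i = 0\<^sub>v m" if "i < n" for i
    using g0[of "n - 1 - i"] that by (simp add: g_def)
  have wpow: "w i \<bullet> v = \<xi> \<bullet> (A ^\<^sub>m i *\<^sub>v v)" if "v \<in> carrier_vec n" for i v
    using that
  proof (induction i arbitrary: v)
    case 0
    then show ?case using A w0 by simp
  next
    case (Suc i)
    have "w (Suc i) \<bullet> v = \<xi> \<bullet> (A ^\<^sub>m i *\<^sub>v (A *\<^sub>v v))"
      using wA Suc A by simp
    also have "A ^\<^sub>m i *\<^sub>v (A *\<^sub>v v) = (A ^\<^sub>m i * A) *\<^sub>v v"
      using assoc_mult_mat_vec[OF pow_carrier_mat[OF A] A Suc.prems] by simp
    finally show ?case by simp
  qed
  \<comment> \<open>The vanishing b_i = B^T (A^T)^i \<open>\<xi>\<close> with \<open>i < n\<close>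
    say that \<open>\<xi>\<close> is orthogonal to every column of the controllability
    matrix.\<close>
  show "\<xi> = 0\<^sub>v n"
  proof (rule full_row_rank_left_kernel[of "ctrb_mat n m A B" n "n * m"])
    fix c assume c: "c < n * m"
    have m: "m > 0" using c by (cases m) auto
    have i: "c div m < n" using c by (simp add: less_mult_imp_div_less)
    have cb: "col B (c mod m) \<in> carrier_vec n" using B m by auto
    have pc: "A ^\<^sub>m (c div m) \<in> carrier_mat n n" using A by simp
    have "col (ctrb_mat n m A B) c = A ^\<^sub>m (c div m) *\<^sub>v col B (c mod m)"
      using c m B carrier_matD[OF pc] by (intro eq_vecI) (auto simp: ctrb_mat_def)
    then have "\<xi> \<bullet> col (ctrb_mat n m A B) c = col B (c mod m) \<bullet> w (c div m)"
      using wpow[OF cb, of "c div m"] cb wc by (metis comm_scalar_prod)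
    also have "\<dots> = b (c div m) $ (c mod m)"
      using B m by (simp add: b_def)
    finally show "\<xi> \<bullet> col (ctrb_mat n m A B) c = 0" using b0[OF i] m by simp
  qed (use ctrb xi in \<open>auto simp: controllable_def ctrb_mat_def\<close>)
qed

text \<open>The converse half: \<open>alpha\<close> is chosen to match the initial state and the
  whole input. Two trajectories that agree in both have the same states, hence the same
  outputs.\<close>

lemma traj_in_hankel_image:
  assumes A: "A \<in> carrier_mat n n" and B: "B \<in> carrier_mat n m"
    and C: "C \<in> carrier_mat p n" and D: "D \<in> carrier_mat p m"
    and ctrb: "controllable n m A B"
    and pe: "pers_exc m (d + n) N ud" and dN: "d + n \<le> N"
    and data: "is_traj n m A B C D N ud yd"
    and traj: "is_traj n m A B C D d ub yb"
  obtains alpha where "alpha \<in> carrier_vec (N - d + 1)"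
    "stack m d ub = hankel m d N ud *\<^sub>v alpha" "stack p d yb = hankel p d N yd *\<^sub>v alpha"
proof -
  obtain x where x0: "x 0 \<in> carrier_vec n"
    and u: "\<And>k. k < N \<Longrightarrow> ud k \<in> carrier_vec m"
    and x: "\<And>k. k < N \<Longrightarrow> x (Suc k) = A *\<^sub>v x k + B *\<^sub>v ud k"
    and y: "\<And>k. k < N \<Longrightarrow> yd k = C *\<^sub>v x k + D *\<^sub>v ud k"
    using data unfolding is_traj_def by blast
  have xc: "x k \<in> carrier_vec n" if "k \<le> N" for k
    using state_carrier[OF A B x0 x u that] by blast
  obtain xb where xb0: "xb 0 \<in> carrier_vec n"
    and ub: "\<And>k. k < d \<Longrightarrow> ub k \<in> carrier_vec m"
    and xb: "\<And>k. k < d \<Longrightarrow> xb (Suc k) = A *\<^sub>v xb k + B *\<^sub>v ub k"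
    and yb: "\<And>k. k < d \<Longrightarrow> yb k = C *\<^sub>v xb k + D *\<^sub>v ub k"
    using traj unfolding is_traj_def by blast
  have xbc: "xb k \<in> carrier_vec n" if "k \<le> d" for k
    using state_carrier[OF A B xb0 xb ub that] by blast
  have ybc: "yb k \<in> carrier_vec p" if "k < d" for k
    using yb[OF that] xbc[of k] ub[OF that] that C D by simp
  let ?M = "N - d + 1"
  let ?X = "window_mat n ?M x 0" and ?H = "hankel m d N ud"
  have c: "?X \<in> carrier_mat n ?M" "?H \<in> carrier_mat (m * d) ?M"
    by (rule window_mat_carrier, rule hankel_carrier)
  have W: "?X @\<^sub>r ?H \<in> carrier_mat (n + m * d) ?M" using c by (rule carrier_append_rows)
  \<comment> \<open>A left kernel vector splits into a state part \<open>\<xi>\<close> and input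
    blocks \<open>\<eta>\<close>; orthogonality to column \<open>k\<close> is the relation handled
    by \<open>willems_left_kernel\<close>.\<close>
  have ker: "v = 0\<^sub>v (n + m * d)"
    if v: "v \<in> carrier_vec (n + m * d)" and z: "(?X @\<^sub>r ?H)\<^sup>T *\<^sub>v v = 0\<^sub>v ?M" for v
  proof -
    define \<xi> where "\<xi> = vec_first v n"
    define h where "h = vec_last v (m * d)"
    define \<eta> where "\<eta> j = vec m (\<lambda>i. h $ (j * m + i))" for j
    have hc: "h \<in> carrier_vec (m * d)" and xic: "\<xi> \<in> carrier_vec n" by (auto simp: h_def \<xi>_def)
    have vs: "v = \<xi> @\<^sub>v h" using v by (simp add: \<xi>_def h_def)
    have hs: "h = stack m d \<eta>"
      using stack_eq_iff[OF hc, of \<eta>] by (simp add: \<eta>_def)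
    have rel: "\<xi> \<bullet> x k + (\<Sum>i<d. \<eta> i \<bullet> ud (k + i)) = 0" if k: "k < ?M" for k
    proof -
      have kd: "k + i < N" if "i < d" for i using k dN that by linarith
      have kN: "k \<le> N" using k dN by linarith
      have cX: "col ?X k = x k" using col_window_mat[OF k, of x 0 n] xc[OF kN] by simp
      have "col (?X @\<^sub>r ?H) k = col ?X k @\<^sub>v col ?H k"
        using c k W by (intro eq_vecI) (auto simp: append_rows_def)
      then have "col (?X @\<^sub>r ?H) k \<bullet> v = col ?X k \<bullet> \<xi> + col ?H k \<bullet> h"
        using scalar_prod_append[OF col_carrier_vec[OF k c(1)] col_carrier_vec[OF k c(2)] xic hc] vs
        by metis
      moreover have "col (?X @\<^sub>r ?H) k \<bullet> v = ((?X @\<^sub>r ?H)\<^sup>T *\<^sub>v v) $ k"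
        using carrier_matD[OF W] k by simp
      moreover have "((?X @\<^sub>r ?H)\<^sup>T *\<^sub>v v) $ k = 0" unfolding z using k by simp
      moreover have "col ?X k \<bullet> \<xi> = \<xi> \<bullet> x k"
        unfolding cX using xc[OF kN] xic by (rule comm_scalar_prod)
      moreover have "col ?H k \<bullet> h = h \<bullet> col ?H k"
        by (rule comm_scalar_prod[OF col_carrier_vec[OF k c(2)] hc])
      moreover have "h \<bullet> col ?H k = (\<Sum>i<d. \<eta> i \<bullet> ud (k + i))"
        unfolding hs col_hankel[OF k] using u kd by (subst scalar_prod_stack) (auto simp: add.commute)
      ultimately show ?thesis by linarith
    qed
    have eta: "\<eta> i \<in> carrier_vec m" for i by (simp add: \<eta>_def)
    note lk = willems_left_kernel[where x = x and u = ud and \<eta> = \<eta>, OF A B ctrb pe dN x xc u xic eta rel]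
    have "h = 0\<^sub>v (m * d)"
      unfolding hs by (subst stack_eq_iff) (auto simp: lk(2) block_index_less)
    then show ?thesis using lk(1) vs by auto
  qed
  have "xb 0 @\<^sub>v stack m d ub \<in> carrier_vec (n + m * d)" using xb0 by simp
  from left_kernel_trivial_imp_surj[OF W ker this]
  obtain alpha where alpha: "alpha \<in> carrier_vec ?M"
    and e: "(?X @\<^sub>r ?H) *\<^sub>v alpha = xb 0 @\<^sub>v stack m d ub" by blast
  have "(?X *\<^sub>v alpha) @\<^sub>v (?H *\<^sub>v alpha) = xb 0 @\<^sub>v stack m d ub"
    using mat_mult_append[OF c alpha] e by simp
  then have e0: "?X *\<^sub>v alpha = xb 0" and eu: "stack m d ub = ?H *\<^sub>v alpha"
    using append_vec_eq[of "?X *\<^sub>v alpha" n "xb 0"] xb0 by auto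
  have ubw: "ub j = window_mat m ?M ud j *\<^sub>v alpha" if "j < d" for j
    using eu stack_eq_hankel_iff[of d ub m N ud alpha] ub that by blast
  have less: "j + c < N" if "j < d" "c < ?M" for j c using that dN by linarith
  have xbw: "xb j = window_mat n ?M x j *\<^sub>v alpha" if "j \<le> d" for j
    using that
  proof (induction j)
    case 0
    then show ?case using e0 by simp
  next
    case (Suc j)
    then have j: "j < d" by simp
    have "window_mat n ?M x (Suc j) *\<^sub>v alpha
        = A *\<^sub>v (window_mat n ?M x j *\<^sub>v alpha) + B *\<^sub>v (window_mat m ?M ud j *\<^sub>v alpha)"
      by (rule window_mat_linear[OF A B alpha]) (use less[OF j] x xc u in \<open>auto simp: less_imp_le\<close>)
    then show ?case using Suc xb[OF j] ubw[OF j] by simp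
  qed
  have "yb j = window_mat p ?M yd j *\<^sub>v alpha" if j: "j < d" for j
  proof -
    have "window_mat p ?M yd j *\<^sub>v alpha
        = C *\<^sub>v (window_mat n ?M x j *\<^sub>v alpha) + D *\<^sub>v (window_mat m ?M ud j *\<^sub>v alpha)"
      by (rule window_mat_linear[OF C D alpha]) (use less[OF j] y xc u in \<open>auto simp: less_imp_le\<close>)
    then show ?thesis using yb[OF j] ubw[OF j] xbw[of j] j by simp
  qed
  then have "stack p d yb = hankel p d N yd *\<^sub>v alpha"
    using stack_eq_hankel_iff[of d yb p N yd alpha] ybc by blast
  then show ?thesis using that alpha eu by blast
qed

section \<open>Extended state\<close>

lemma ext_state_carrier [simp]: "ext_state m p l u y t \<in> carrier_vec ((m + p) * l)"
  unfolding ext_state_def add_mult_distrib by (intro append_carrier_vec stack_carrier)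

lemma dim_ext_state [simp]: "dim_vec (ext_state m p l u y t) = (m + p) * l"
  using ext_state_carrier by (rule carrier_vecD)

lemma ext_state_index_input:
  assumes "j < l" "i < m"
  shows "ext_state m p l u y t $ (j * m + i) = u (t + j) $ i"
  using block_index_less[OF assms] stack_index[OF assms, of "\<lambda>j. u (t + j)"]
  by (simp add: ext_state_def)

lemma ext_state_index_output:
  assumes "j < l" "i < p"
  shows "ext_state m p l u y t $ (m * l + (j * p + i)) = y (t + j) $ i"
  using block_index_less[OF assms] stack_index[OF assms, of "\<lambda>j. y (t + j)"]
  by (simp add: ext_state_def)

lemma ext_index_less:
  fixes m p l i j :: nat
  shows "j < l \<Longrightarrow> i < m \<Longrightarrow> j * m + i < (m + p) * l"
    and "j < l \<Longrightarrow> i < p \<Longrightarrow> m * l + (j * p + i) < (m + p) * l"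
  using block_index_less[of j l i m] block_index_less[of j l i p] by (auto simp: add_mult_distrib)

lemma ext_vec_eqI:
  assumes v: "v \<in> carrier_vec ((m + p) * l)" and w: "w \<in> carrier_vec ((m + p) * l)"
    and inp: "\<And>j i. j < l \<Longrightarrow> i < m \<Longrightarrow> v $ (j * m + i) = w $ (j * m + i)"
    and out: "\<And>j i. j < l \<Longrightarrow> i < p \<Longrightarrow> v $ (m * l + (j * p + i)) = w $ (m * l + (j * p + i))"
  shows "v = w"
proof (rule eq_vecI)
  fix r assume "r < dim_vec w"
  then have r: "r < m * l + p * l" using w by (simp add: add_mult_distrib)
  show "v $ r = w $ r"
  proof (cases "r < m * l")
    case True
    then obtain i j where "j < l" "i < m" "r = j * m + i" by (rule block_index_cases)
    then show ?thesis using inp by simp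
  next
    case False
    then have "r - m * l < p * l" using r by linarith
    then obtain i j where ij: "j < l" "i < p" "r - m * l = j * p + i" by (rule block_index_cases)
    have "r = m * l + (j * p + i)" using ij(3) False by linarith
    then show ?thesis using out ij by simp
  qed
qed (use v w in simp)

lemma ext_state_cong:
  assumes "\<And>j. j < l \<Longrightarrow> u (s + j) = u' (t + j)" "\<And>j. j < l \<Longrightarrow> y (s + j) = y' (t + j)"
  shows "ext_state m p l u y s = ext_state m p l u' y' t"
  by (rule ext_vec_eqI[of _ m p l]) (auto simp: ext_state_index_input ext_state_index_output assms)

lemma ext_state_minus:
  assumes "us \<in> carrier_vec m" "ys \<in> carrier_vec p"
  shows "ext_state m p l u y t - ext_state m p l (\<lambda>_. us) (\<lambda>_. ys) 0
    = ext_state m p l (\<lambda>k. u k - us) (\<lambda>k. y k - ys) t"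
  by (rule ext_vec_eqI[of _ m p l])
    (use assms in \<open>auto simp: ext_state_index_input ext_state_index_output ext_index_less\<close>)

lemma ext_state_sq_norm:
  assumes u: "\<And>j. j < l \<Longrightarrow> u (t + j) \<in> carrier_vec m" and y: "\<And>j. j < l \<Longrightarrow> y (t + j) \<in> carrier_vec p"
  shows "ext_state m p l u y t \<bullet> ext_state m p l u y t
    = (\<Sum>j<l. u (t + j) \<bullet> u (t + j) + y (t + j) \<bullet> y (t + j))"
proof -
  have "ext_state m p l u y t \<bullet> ext_state m p l u y t
      = stack m l (\<lambda>j. u (t + j)) \<bullet> stack m l (\<lambda>j. u (t + j))
        + stack p l (\<lambda>j. y (t + j)) \<bullet> stack p l (\<lambda>j. y (t + j))"
    unfolding ext_state_def by (rule scalar_prod_append[OF stack_carrier stack_carrier stack_carrier stack_carrier])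
  then show ?thesis using u y by (simp add: scalar_prod_stack sum.distrib)
qed

section \<open>The matrices of the extended dynamics\<close>

lemma At_carrier [simp]: "At m p l G F \<in> carrier_mat ((m + p) * l) ((m + p) * l)"
  by (simp add: At_def)

lemma Bt_carrier [simp]: "Bt m p l D \<in> carrier_mat ((m + p) * l) m"
  by (simp add: Bt_def)

lemma Ct_carrier [simp]: "Ct m p l G F \<in> carrier_mat p ((m + p) * l)"
  by (simp add: Ct_def)

lemma row_At_input:
  assumes "j < l" "i < m"
  shows "row (At m p l G F) (j * m + i)
    = (if j < l - 1 then unit_vec ((m + p) * l) (Suc j * m + i) else 0\<^sub>v ((m + p) * l))"
  using assms block_index_less[OF assms] ext_index_less(1)[OF assms, of p]
  by (intro eq_vecI) (auto simp: At_def unit_vec_def)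

lemma row_At_output:
  assumes "j < l" "i < p"
  shows "row (At m p l G F) (m * l + (j * p + i))
    = (if j < l - 1 then unit_vec ((m + p) * l) (m * l + (Suc j * p + i)) else row (Ct m p l G F) i)"
  using assms ext_index_less(2)[OF assms, of m]
  by (intro eq_vecI) (auto simp: At_def Ct_def unit_vec_def)

lemma row_Bt_input:
  assumes "j < l" "i < m"
  shows "row (Bt m p l D) (j * m + i) = (if j = l - 1 then unit_vec m i else 0\<^sub>v m)"
  using assms block_index_less[OF assms] ext_index_less(1)[OF assms, of p]
  by (intro eq_vecI) (auto simp: Bt_def unit_vec_def)

lemma row_Bt_output:
  assumes "j < l" "i < p" "D \<in> carrier_mat p m"
  shows "row (Bt m p l D) (m * l + (j * p + i)) = (if j = l - 1 then row D i else 0\<^sub>v m)"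
  using assms ext_index_less(2)[OF assms(1,2), of m]
  by (intro eq_vecI) (auto simp: Bt_def)

text \<open>Block \<open>j\<close> of the new window is block \<open>j + 1\<close> of the old one,
  and only the two newest blocks are computed. The output equation at the single time
  \<open>t + l\<close> is all that is asked of the sequences, so the lemma applies both to the
  constant steady state and to the prolonged prediction.\<close>

lemma ext_state_Suc:
  assumes D: "D \<in> carrier_mat p m" and u: "u (t + l) \<in> carrier_vec m"
    and y: "y (t + l) = Ct m p l G F *\<^sub>v ext_state m p l u y t + D *\<^sub>v u (t + l)"
  shows "ext_state m p l u y (Suc t)
    = At m p l G F *\<^sub>v ext_state m p l u y t + Bt m p l D *\<^sub>v u (t + l)"
proof (rule ext_vec_eqI[of _ m p l])
  let ?xi = "ext_state m p l u y t"
  note dims = carrier_matD[OF At_carrier[of m p l G F]] carrier_matD[OF Bt_carrier[of m p l D]]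
    carrier_matD[OF Ct_carrier[of m p l G F]]
  show "At m p l G F *\<^sub>v ?xi + Bt m p l D *\<^sub>v u (t + l) \<in> carrier_vec ((m + p) * l)"
    by (rule carrier_vecI) (simp add: dims)
  fix j i assume j: "j < l"
  have last: "t + l = Suc (t + j)" if "\<not> j < l - 1" using that j by simp
  have sj: "Suc j < l" if "j < l - 1" using that by simp
  {
    assume i: "i < m"
    show "ext_state m p l u y (Suc t) $ (j * m + i)
        = (At m p l G F *\<^sub>v ?xi + Bt m p l D *\<^sub>v u (t + l)) $ (j * m + i)"
      using u last ext_index_less(1)[OF j i, of p] ext_index_less(1)[OF sj i, of p]
        ext_state_index_input[OF j i, of p u y "Suc t"] ext_state_index_input[OF sj i, of p u y t]
        scalar_prod_left_unit[OF u i]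
      by (auto simp: dims row_At_input[OF j i] row_Bt_input[OF j i]
          scalar_prod_left_unit[OF ext_state_carrier] simp del: mult_Suc)
  next
    assume i: "i < p"
    show "ext_state m p l u y (Suc t) $ (m * l + (j * p + i))
        = (At m p l G F *\<^sub>v ?xi + Bt m p l D *\<^sub>v u (t + l)) $ (m * l + (j * p + i))"
    proof (cases "j < l - 1")
      case True
      then show ?thesis
        using u ext_index_less(2)[OF j i, of m] ext_index_less(2)[OF sj[OF True] i, of m]
          ext_state_index_output[OF j i, of m u y "Suc t"] ext_state_index_output[OF sj[OF True] i, of m u y t]
        by (auto simp: dims row_At_output[OF j i] row_Bt_output[OF j i D]
            scalar_prod_left_unit[OF ext_state_carrier] simp del: mult_Suc)
    next
      case False
      have "y (t + l) $ i = row (Ct m p l G F) i \<bullet> ?xi + row D i \<bullet> u (t + l)"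
        using arg_cong[OF y, of "\<lambda>v. v $ i"] i D by (simp add: dims)
      moreover have "row (At m p l G F) (m * l + (j * p + i)) = row (Ct m p l G F) i"
        using row_At_output[OF j i] False by simp
      moreover have "row (Bt m p l D) (m * l + (j * p + i)) = row D i"
        using row_Bt_output[OF j i D] False j by (auto split: if_splits)
      moreover have "ext_state m p l u y (Suc t) $ (m * l + (j * p + i)) = y (t + l) $ i"
        using ext_state_index_output[OF j i, of m u y "Suc t"] last[OF False] by simp
      ultimately show ?thesis using ext_index_less(2)[OF j i, of m] by (simp add: dims)
    qed
  }
qed simp

text \<open>For \<open>n > 0\<close> the index \<open>n\<close> itself is a witness. For
  \<open>n = 0\<close> no index satisfies \<open>1 \<le> l \<and> l \<le> n\<close>, so
  \<open>LEAST\<close> says nothing.\<close>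

lemma lag_properties:
  assumes "observable n p A C" "0 < n"
  shows "1 \<le> lag n p A C" "mrank (obsv_mat n p (lag n p A C) A C) = n"
proof -
  have "1 \<le> n \<and> n \<le> n \<and> mrank (obsv_mat n p n A C) = n"
    using assms by (auto simp: observable_def)
  from LeastI[of "\<lambda>l. 1 \<le> l \<and> l \<le> n \<and> mrank (obsv_mat n p l A C) = n", OF this]
  show "1 \<le> lag n p A C" "mrank (obsv_mat n p (lag n p A C) A C) = n"
    unfolding lag_def by auto
qed

lemma mult_pow_mat:
  fixes A :: "real mat"
  assumes A: "A \<in> carrier_mat n n"
  shows "A * A ^\<^sub>m k = A ^\<^sub>m Suc k"
proof (induction k)
  case 0
  then show ?case using A by simp
next
  case (Suc k)
  have "A * A ^\<^sub>m Suc k = (A * A ^\<^sub>m k) * A"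
    using assoc_mult_mat[OF A pow_carrier_mat[OF A, of k] A] by simp
  then show ?case using Suc by simp
qed

text \<open>Consecutive states of a constant trajectory of length \<open>lag + 1\<close> differ by a vector that the
  observability matrix annihilates.\<close>
lemma equilibrium_obtain_state:
  assumes A: "A \<in> carrier_mat n n" and B: "B \<in> carrier_mat n m"
    and C: "C \<in> carrier_mat p n" and D: "D \<in> carrier_mat p m"
    and obsv: "observable n p A C" and eq: "equilibrium n m p A B C D us ys"
  obtains xs where "xs \<in> carrier_vec n" "xs = A *\<^sub>v xs + B *\<^sub>v us" "ys = C *\<^sub>v xs + D *\<^sub>v us"
proof -
  let ?g = "lag n p A C"
  obtain x where x0: "x 0 \<in> carrier_vec n" and us: "us \<in> carrier_vec m"
    and x: "\<And>k. k < Suc ?g \<Longrightarrow> x (Suc k) = A *\<^sub>v x k + B *\<^sub>v us"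
    and y: "\<And>k. k < Suc ?g \<Longrightarrow> ys = C *\<^sub>v x k + D *\<^sub>v us"
    using eq unfolding equilibrium_def is_traj_def by blast
  have xc: "x k \<in> carrier_vec n" if "k \<le> Suc ?g" for k
    by (rule state_carrier[where u = "\<lambda>_. us", OF A B x0 x us that])
  define e where "e = x 1 - x 0"
  have ec: "e \<in> carrier_vec n" using xc[of 0] xc[of 1] by (simp add: e_def)
  have diff: "x (Suc k) - x k = A ^\<^sub>m k *\<^sub>v e" if "k \<le> ?g" for k
    using that
  proof (induction k)
    case 0
    then show ?case using A ec by (simp add: e_def)
  next
    case (Suc k)
    have c: "x k \<in> carrier_vec n" "x (Suc k) \<in> carrier_vec n" using xc Suc.prems by auto
    have "x (Suc (Suc k)) - x (Suc k) = (A *\<^sub>v x (Suc k) + B *\<^sub>v us) - (A *\<^sub>v x k + B *\<^sub>v us)"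
      using x[of k] x[of "Suc k"] Suc.prems by simp
    also have "\<dots> = A *\<^sub>v x (Suc k) - A *\<^sub>v x k"
      using c A B us by (intro eq_vecI) auto
    also have "\<dots> = A *\<^sub>v (A ^\<^sub>m k *\<^sub>v e)"
      using mult_minus_distrib_mat_vec[OF A c(2,1)] Suc by simp
    also have "\<dots> = (A * A ^\<^sub>m k) *\<^sub>v e"
      using assoc_mult_mat_vec[OF A pow_carrier_mat[OF A] ec] by simp
    also have "A * A ^\<^sub>m k = A ^\<^sub>m Suc k"
      using mult_pow_mat[OF A] .
    finally show ?case .
  qed
  have e0: "e = 0\<^sub>v n"
  proof (cases "n = 0")
    case True
    then show ?thesis using ec by auto
  next
    case False
    \<comment> \<open>Block \<open>j\<close> of the product is C (x_(j+1) - x_j). Both outputs equal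
      \<open>ys\<close> under the same input; a trajectory of length \<open>lag + 1\<close> is just
      long enough for this to hold for all \<open>j < lag\<close>.\<close>
    have "obsv_mat n p ?g A C *\<^sub>v e = 0\<^sub>v (p * ?g)"
    proof (rule eq_vecI)
      fix r assume "r < dim_vec (0\<^sub>v (p * ?g) :: real vec)"
      then have r: "r < p * ?g" by simp
      then obtain i j where ij: "j < ?g" "i < p" "r = j * p + i" by (rule block_index_cases)
      have c: "x j \<in> carrier_vec n" "x (Suc j) \<in> carrier_vec n" using xc ij by auto
      have "row (obsv_mat n p ?g A C) r = row (C * A ^\<^sub>m j) i"
        using r ij carrier_matD[OF mult_carrier_mat[OF C pow_carrier_mat[OF A, of j]]]
        by (intro eq_vecI) (simp_all add: obsv_mat_def del: index_mult_mat)
      then have "(obsv_mat n p ?g A C *\<^sub>v e) $ r = ((C * A ^\<^sub>m j) *\<^sub>v e) $ i"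
        using r ij C by (simp add: obsv_mat_def)
      also have "(C * A ^\<^sub>m j) *\<^sub>v e = C *\<^sub>v (x (Suc j) - x j)"
        using assoc_mult_mat_vec[OF C pow_carrier_mat[OF A] ec] diff[of j] ij by simp
      also have "\<dots> = C *\<^sub>v x (Suc j) - C *\<^sub>v x j"
        using mult_minus_distrib_mat_vec[OF C c(2,1)] .
      also have "\<dots> $ i = 0"
      proof -
        have "(C *\<^sub>v x (Suc j) + D *\<^sub>v us) $ i = (C *\<^sub>v x j + D *\<^sub>v us) $ i"
          using y[of j] y[of "Suc j"] ij by simp
        then show ?thesis using ij C D by simp
      qed
      finally show "(obsv_mat n p ?g A C *\<^sub>v e) $ r = 0\<^sub>v (p * ?g) $ r" using r by simp
    qed (simp add: obsv_mat_def)
    then show ?thesis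
      using full_col_rank_inj[of "obsv_mat n p ?g A C" "p * ?g" n e] lag_properties(2)[OF obsv] ec False
      by (simp add: obsv_mat_def)
  qed
  have "x 1 = x 0"
  proof (rule eq_vecI)
    fix i assume "i < dim_vec (x 0)"
    then have i: "i < n" using x0 by simp
    have "x 1 $ i - x 0 $ i = e $ i" using i x0 by (simp add: e_def)
    then show "x 1 $ i = x 0 $ i" using e0 i by simp
  qed (use xc[of 0] xc[of 1] in simp)
  then show ?thesis using that[of "x 0"] x[of 0] y[of 0] x0 by simp
qed

section \<open>Recursive feasibility and stability\<close>

lemma ext_state_eqD:
  assumes e: "ext_state m p l u y s = ext_state m p l u' y' t" and j: "j < l"
    and "u (s + j) \<in> carrier_vec m" "u' (t + j) \<in> carrier_vec m"
    and "y (s + j) \<in> carrier_vec p" "y' (t + j) \<in> carrier_vec p"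
  shows "u (s + j) = u' (t + j)" "y (s + j) = y' (t + j)"
proof -
  have "u (s + j) $ i = u' (t + j) $ i" if "i < m" for i
    using arg_cong[OF e, of "\<lambda>v. v $ (j * m + i)"] by (simp add: ext_state_index_input j that)
  then show "u (s + j) = u' (t + j)" using assms by (intro eq_vecI) auto
  have "y (s + j) $ i = y' (t + j) $ i" if "i < p" for i
    using arg_cong[OF e, of "\<lambda>v. v $ (m * l + (j * p + i))"] by (simp add: ext_state_index_output j that)
  then show "y (s + j) = y' (t + j)" using assms by (intro eq_vecI) auto
qed

lemma qf_congruence:
  assumes K: "K \<in> carrier_mat m d" and R: "R \<in> carrier_mat m m" and z: "z \<in> carrier_vec d"
  shows "qf (K\<^sup>T * R * K) z = qf R (K *\<^sub>v z)"
proof -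
  have KT: "K\<^sup>T \<in> carrier_mat d m" using K by simp
  have Kz: "K *\<^sub>v z \<in> carrier_vec m" using K z by simp
  have w: "R *\<^sub>v (K *\<^sub>v z) \<in> carrier_vec m" using R Kz by simp
  have "(K\<^sup>T * R * K) *\<^sub>v z = K\<^sup>T *\<^sub>v (R *\<^sub>v (K *\<^sub>v z))"
    using assoc_mult_mat_vec[OF mult_carrier_mat[OF KT R] K z] assoc_mult_mat_vec[OF KT R Kz] by simp
  then have "qf (K\<^sup>T * R * K) z = z \<bullet> (K\<^sup>T *\<^sub>v (R *\<^sub>v (K *\<^sub>v z)))" by (simp add: qf_def)
  also have "\<dots> = (K\<^sup>T *\<^sub>v (R *\<^sub>v (K *\<^sub>v z))) \<bullet> z"
    by (rule comm_scalar_prod[OF z mult_mat_vec_carrier[OF KT w]])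
  also have "\<dots> = (R *\<^sub>v (K *\<^sub>v z)) \<bullet> (K *\<^sub>v z)"
    by (rule transpose_vec_mult_scalar[OF K z w])
  also have "\<dots> = qf R (K *\<^sub>v z)"
    unfolding qf_def by (rule comm_scalar_prod[OF w Kz])
  finally show ?thesis .
qed

lemma is_traj_inf_imp_is_traj: "is_traj_inf n m A B C D u y \<Longrightarrow> is_traj n m A B C D N u y"
  unfolding is_traj_def is_traj_inf_def by blast

lemma is_traj_inf_carrier:
  assumes D: "D \<in> carrier_mat p m" and traj: "is_traj_inf n m A B C D u y"
  shows "u k \<in> carrier_vec m" "y k \<in> carrier_vec p"
proof -
  obtain x where "u k \<in> carrier_vec m" "y k = C *\<^sub>v x k + D *\<^sub>v u k"
    using traj by (auto simp: is_traj_inf_def)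
  then show "u k \<in> carrier_vec m" "y k \<in> carrier_vec p"
    using D by (auto intro!: carrier_vecI)
qed

text \<open>Minimisers are supplied by the closed loop itself, so the infimum is evaluated without a
  compactness argument.\<close>

lemma optimal_imp_value_eq_cost:
  assumes "ocp_optimal_sol m p l L N ud yd U Y Xf Q R P us ys xis xi alpha ub yb"
  shows "ocp_value m p l L N ud yd U Y Xf Q R P us ys xis xi = ocp_cost m p l L Q R P us ys xis ub yb"
  unfolding ocp_value_def
  by (rule cInf_eq_minimum) (use assms in \<open>auto simp: ocp_optimal_sol_def\<close>)

text \<open>All remaining summands are nonnegative. This gives nonnegative optimal values and, where
  the value is at most zero, forces the first input to be \<open>us\<close>.\<close>

lemma ocp_cost_ge_stage:
  assumes Q: "pos_def p Q" and R: "pos_def m R" and P: "pos_def ((m + p) * l) P"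
    and xis: "xis \<in> carrier_vec ((m + p) * l)"
    and us: "us \<in> carrier_vec m" and ys: "ys \<in> carrier_vec p" and L: "1 \<le> L"
    and sol: "ocp_feasible_sol m p l L N ud yd U Y Xf xi alpha ub yb"
  shows "qf R (ub l - us) + qf Q (yb l - ys) \<le> ocp_cost m p l L Q R P us ys xis ub yb"
    and "0 \<le> qf R (ub l - us)" "0 \<le> qf Q (yb l - ys)"
proof -
  let ?s = "\<lambda>k. qf R (ub (l + k) - us) + qf Q (yb (l + k) - ys)"
  have c: "ub (l + k) \<in> carrier_vec m" "yb (l + k) \<in> carrier_vec p" if "k < L" for k
    using sol that by (auto simp: ocp_feasible_sol_def)
  have nn: "0 \<le> qf R (ub (l + k) - us)" "0 \<le> qf Q (yb (l + k) - ys)" if "k < L" for k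
    using qf_nonneg[OF R, of "ub (l + k) - us"] qf_nonneg[OF Q, of "yb (l + k) - ys"] c[OF that] us ys
    by simp_all
  have "?s 0 \<le> (\<Sum>k<L. ?s k)"
    by (rule member_le_sum) (use L nn in \<open>auto intro: add_nonneg_nonneg\<close>)
  moreover have "0 \<le> qf P (ext_state m p l ub yb L - xis)"
    by (rule qf_nonneg[OF P]) (use xis in simp)
  ultimately show "qf R (ub l - us) + qf Q (yb l - ys) \<le> ocp_cost m p l L Q R P us ys xis ub yb"
    by (simp add: ocp_cost_def)
  show "0 \<le> qf R (ub l - us)" "0 \<le> qf Q (yb l - ys)" using nn[of 0] L by auto
qed

text \<open>The setting in which the fundamental lemma applies: besides the hypotheses of the
  theorem it contains \<open>N_ge\<close>, which the theorem derives from \<open>pe\<close> when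
  \<open>m\<close> and \<open>l\<close> are positive.\<close>

locale data_driven_mpc =
  fixes n m p l L N :: nat
    and A B C D Q R P K :: "real mat"
    and G F :: "nat \<Rightarrow> real mat"
    and ud yd :: "nat \<Rightarrow> real vec"
    and U Y Xf :: "real vec set"
    and us ys xis :: "real vec"
  assumes A: "A \<in> carrier_mat n n" and B: "B \<in> carrier_mat n m"
    and C: "C \<in> carrier_mat p n" and D: "D \<in> carrier_mat p m"
    and ctrb: "controllable n m A B"
    and obsv: "observable n p A C"
    and GF_ext: "is_traj n m A B C D N' u y \<Longrightarrow> l \<le> k \<Longrightarrow> k < N' \<Longrightarrow>
           y k = Ct m p l G F *\<^sub>v ext_state m p l u y (k - l) + D *\<^sub>v u k"
    and data: "is_traj n m A B C D N ud yd"
    and eq: "equilibrium n m p A B C D us ys"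
    and Q: "pos_def p Q" and R: "pos_def m R"
    and L_ge: "1 \<le> L"
    and P: "pos_def ((m + p) * l) P"
    and K: "K \<in> carrier_mat m ((m + p) * l)"
    and terminal: "xi \<in> Xf \<Longrightarrow>
        let u = us + K *\<^sub>v (xi - xis); y = Ct m p l G F *\<^sub>v xi + D *\<^sub>v u in
          At m p l G F *\<^sub>v xi + Bt m p l D *\<^sub>v u \<in> Xf \<and>
          u \<in> U \<and> y \<in> Y \<and>
          qf P ((At m p l G F + Bt m p l D * K) *\<^sub>v (xi - xis))
            \<le> qf P (xi - xis) - qf (transpose_mat K * R * K) (xi - xis) - qf Q (y - ys)"
    and pe: "pers_exc m (L + l + n) N ud"
    and N_ge: "L + l + n \<le> N"
    and xis_eq: "xis = ext_state m p l (\<lambda>_. us) (\<lambda>_. ys) 0"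
begin

abbreviation "feasible_sol \<equiv> ocp_feasible_sol m p l L N ud yd U Y Xf"
abbreviation "cost \<equiv> ocp_cost m p l L Q R P us ys xis"

lemma us_carrier: "us \<in> carrier_vec m" and ys_carrier: "ys \<in> carrier_vec p"
  using eq by (auto simp: equilibrium_def)

lemma xis_carrier: "xis \<in> carrier_vec ((m + p) * l)"
  by (simp add: xis_eq)

text \<open>The definition of an equilibrium offers a constant trajectory of length
  \<open>lag + 1\<close>. A stationary internal state prolongs it to length \<open>l + 1\<close>,
  where \<open>GF_ext\<close> applies at time \<open>l\<close>.\<close>

lemma steady_state_fixed_point: "At m p l G F *\<^sub>v xis + Bt m p l D *\<^sub>v us = xis"
proof -
  obtain xs where "xs \<in> carrier_vec n" "xs = A *\<^sub>v xs + B *\<^sub>v us" "ys = C *\<^sub>v xs + D *\<^sub>v us"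
    using equilibrium_obtain_state[OF A B C D obsv eq] .
  then have "is_traj n m A B C D (Suc l) (\<lambda>_. us) (\<lambda>_. ys)"
    unfolding is_traj_def using us_carrier by (intro exI[of _ "\<lambda>_. xs"]) auto
  from GF_ext[OF this, of l]
  have "ys = Ct m p l G F *\<^sub>v xis + D *\<^sub>v us" by (simp add: xis_eq)
  from ext_state_Suc[of D p m "\<lambda>_. us" 0 l "\<lambda>_. ys" G F, OF D us_carrier this[unfolded xis_eq]]
  have "At m p l G F *\<^sub>v xis + Bt m p l D *\<^sub>v us = ext_state m p l (\<lambda>_. us) (\<lambda>_. ys) (Suc 0)"
    by (simp add: xis_eq)
  also have "\<dots> = xis" unfolding xis_eq by (rule ext_state_cong) auto
  finally show ?thesis .
qed

text \<open>Subtracting the fixed point equation leaves linear dynamics of the deviation, the form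
  in which the terminal decrease is assumed.\<close>

lemma terminal_deviation:
  assumes xi: "xi \<in> carrier_vec ((m + p) * l)"
  shows "(At m p l G F *\<^sub>v xi + Bt m p l D *\<^sub>v (us + K *\<^sub>v (xi - xis))) - xis
    = (At m p l G F + Bt m p l D * K) *\<^sub>v (xi - xis)"
proof -
  let ?d = "(m + p) * l" and ?A = "At m p l G F" and ?B = "Bt m p l D"
  define z where "z = xi - xis"
  have z: "z \<in> carrier_vec ?d" using xi xis_carrier by (simp add: z_def)
  have Kz: "K *\<^sub>v z \<in> carrier_vec m" using K z by simp
  have xi_z: "xi = xis + z"
    using xi xis_carrier by (intro eq_vecI) (auto simp: z_def)
  have c: "?A *\<^sub>v xis \<in> carrier_vec ?d" "?A *\<^sub>v z \<in> carrier_vec ?d"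
    "?B *\<^sub>v us \<in> carrier_vec ?d" "?B *\<^sub>v (K *\<^sub>v z) \<in> carrier_vec ?d"
    by (fact mult_mat_vec_carrier[OF At_carrier xis_carrier] mult_mat_vec_carrier[OF At_carrier z]
        mult_mat_vec_carrier[OF Bt_carrier us_carrier] mult_mat_vec_carrier[OF Bt_carrier Kz])+
  have "(?A *\<^sub>v (xis + z) + ?B *\<^sub>v (us + K *\<^sub>v z)) - xis
      = (?A *\<^sub>v xis + ?A *\<^sub>v z + (?B *\<^sub>v us + ?B *\<^sub>v (K *\<^sub>v z))) - (?A *\<^sub>v xis + ?B *\<^sub>v us)"
    unfolding steady_state_fixed_point
      mult_add_distrib_mat_vec[OF At_carrier xis_carrier z] mult_add_distrib_mat_vec[OF Bt_carrier us_carrier Kz] ..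
  also have "\<dots> = ?A *\<^sub>v z + ?B *\<^sub>v (K *\<^sub>v z)"
    using carrier_vecD[OF c(1)] carrier_vecD[OF c(2)] carrier_vecD[OF c(3)] carrier_vecD[OF c(4)]
    by (intro eq_vecI) (simp_all del: index_mult_mat_vec dim_mult_mat_vec)
  also have "\<dots> = (?A + ?B * K) *\<^sub>v z"
    using add_mult_distrib_mat_vec[OF At_carrier mult_carrier_mat[OF Bt_carrier K] z]
      assoc_mult_mat_vec[OF Bt_carrier K z] by simp
  finally show ?thesis unfolding z_def[symmetric] by (simp only: xi_z[symmetric])
qed

lemma feasible_sol_is_traj:
  assumes "feasible_sol xi alpha ub yb"
  shows "is_traj n m A B C D (L + l) ub yb"
proof (rule hankel_image_is_traj[OF A B C D data])
  show "L + l \<le> N" using N_ge by simp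
  show "alpha \<in> carrier_vec (N - (L + l) + 1)" using assms unfolding ocp_feasible_sol_def by blast
  show "ub j = window_mat m (N - (L + l) + 1) ud j *\<^sub>v alpha" if "j < L + l" for j
    using assms that stack_eq_hankel_iff[of "L + l" ub m N ud alpha] unfolding ocp_feasible_sol_def by blast
  show "yb j = window_mat p (N - (L + l) + 1) yd j *\<^sub>v alpha" if "j < L + l" for j
    using assms that stack_eq_hankel_iff[of "L + l" yb p N yd alpha] unfolding ocp_feasible_sol_def by blast
qed

text \<open>The candidate solution shifts the prediction by one step and appends the terminal controller;
  Willems' lemma represents it by the data.\<close>
lemma shifted_candidate:
  assumes sol: "feasible_sol xi alpha ub yb"
  obtains alpha' ub' yb' where "feasible_sol (ext_state m p l ub yb 1) alpha' ub' yb'"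
    "cost ub' yb' \<le> cost ub yb - (qf R (ub l - us) + qf Q (yb l - ys))"
proof -
  let ?T = "L + l"
  obtain x where x0: "x 0 \<in> carrier_vec n"
    and ubc: "\<And>k. k < ?T \<Longrightarrow> ub k \<in> carrier_vec m"
    and x: "\<And>k. k < ?T \<Longrightarrow> x (Suc k) = A *\<^sub>v x k + B *\<^sub>v ub k"
    and y: "\<And>k. k < ?T \<Longrightarrow> yb k = C *\<^sub>v x k + D *\<^sub>v ub k"
    using feasible_sol_is_traj[OF sol] unfolding is_traj_def by blast
  have xc: "x k \<in> carrier_vec n" if "k \<le> ?T" for k
    by (rule state_carrier[OF A B x0 x ubc that])
  define xL where "xL = ext_state m p l ub yb L"
  have xLc: "xL \<in> carrier_vec ((m + p) * l)" by (simp add: xL_def)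
  have xL_Xf: "xL \<in> Xf" using sol by (simp add: ocp_feasible_sol_def xL_def)
  define uL where "uL = us + K *\<^sub>v (xL - xis)"
  have uLc: "uL \<in> carrier_vec m" using us_carrier K xLc xis_carrier by (simp add: uL_def)
  define u2 where "u2 = ub(?T := uL)"
  define y2 where "y2 = yb(?T := C *\<^sub>v x ?T + D *\<^sub>v uL)"
  define x2 where "x2 = x(Suc ?T := A *\<^sub>v x ?T + B *\<^sub>v uL)"
  have old: "u2 k = ub k" "y2 k = yb k" if "k < ?T" for k using that by (auto simp: u2_def y2_def)
  have step2: "u2 k \<in> carrier_vec m \<and> x2 (Suc k) = A *\<^sub>v x2 k + B *\<^sub>v u2 k \<and> y2 k = C *\<^sub>v x2 k + D *\<^sub>v u2 k"
    if "k < Suc ?T" for k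
    using that uLc ubc x y by (cases "k = ?T") (auto simp: u2_def y2_def x2_def)
  have traj2: "is_traj n m A B C D (Suc ?T) u2 y2"
    unfolding is_traj_def using step2 x0 by (intro exI[of _ x2]) (auto simp: x2_def)
  have xL2: "ext_state m p l u2 y2 L = xL"
    unfolding xL_def by (rule ext_state_cong) (simp_all add: old)
  \<comment> \<open>The appended output comes from the true internal state; \<open>GF_ext\<close> at
    time \<open>L + l\<close> identifies it with the output in the terminal condition.\<close>
  have yL: "y2 ?T = Ct m p l G F *\<^sub>v xL + D *\<^sub>v uL"
    using GF_ext[OF traj2, of ?T] xL2 by (simp add: u2_def)
  have next_eq: "ext_state m p l u2 y2 (Suc L) = At m p l G F *\<^sub>v xL + Bt m p l D *\<^sub>v uL"
    using ext_state_Suc[of D p m u2 L l y2 G F] D uLc yL xL2 by (simp add: u2_def)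
  have terminal_L: "ext_state m p l u2 y2 (Suc L) \<in> Xf" "uL \<in> U" "y2 ?T \<in> Y"
    "qf P ((At m p l G F + Bt m p l D * K) *\<^sub>v (xL - xis))
      \<le> qf P (xL - xis) - qf (K\<^sup>T * R * K) (xL - xis) - qf Q (y2 ?T - ys)"
    using terminal[OF xL_Xf] unfolding next_eq yL by (simp_all add: Let_def uL_def)
  have "K *\<^sub>v (xL - xis) = uL - us"
    using us_carrier K by (intro eq_vecI) (auto simp: uL_def)
  then have qfR: "qf (K\<^sup>T * R * K) (xL - xis) = qf R (uL - us)"
    using qf_congruence[OF K, of R "xL - xis"] R xLc xis_carrier by (simp add: pos_def_def)
  have dev: "ext_state m p l u2 y2 (Suc L) - xis = (At m p l G F + Bt m p l D * K) *\<^sub>v (xL - xis)"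
    unfolding next_eq uL_def by (rule terminal_deviation[OF xLc])
  let ?u = "\<lambda>k. u2 (Suc k)" and ?y = "\<lambda>k. y2 (Suc k)"
  have "is_traj n m A B C D ?T ?u ?y"
    unfolding is_traj_def using step2 x0 xc[of 1] L_ge
    by (intro exI[of _ "\<lambda>k. x2 (Suc k)"]) (auto simp: x2_def)
  from traj_in_hankel_image[OF A B C D ctrb pe N_ge data this]
  obtain alpha' where alpha': "alpha' \<in> carrier_vec (N - ?T + 1)"
    "stack m ?T ?u = hankel m ?T N ud *\<^sub>v alpha'" "stack p ?T ?y = hankel p ?T N yd *\<^sub>v alpha'" .
  have shift: "ext_state m p l ?u ?y k = ext_state m p l u2 y2 (Suc k)" for k
    by (rule ext_state_cong) auto
  have start: "ext_state m p l ?u ?y 0 = ext_state m p l ub yb 1"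
    unfolding shift by (rule ext_state_cong) (use L_ge in \<open>auto simp: old\<close>)
  have carr: "?u j \<in> carrier_vec m" "?y j \<in> carrier_vec p" if "j < ?T" for j
  proof -
    have "x2 (Suc j) \<in> carrier_vec n" using xc that by (auto simp: x2_def)
    then show "?u j \<in> carrier_vec m" "?y j \<in> carrier_vec p"
      using step2[of "Suc j"] that C D by auto
  qed
  \<comment> \<open>Only the newest pair, at \<open>k = L - 1\<close>, comes from the terminal
    controller; all others are inherited.\<close>
  have constr: "?u (l + k) \<in> U \<and> ?y (l + k) \<in> Y" if "k < L" for k
  proof (cases "Suc k = L")
    case True
    then have last: "Suc (l + k) = ?T" by simp
    show ?thesis unfolding last using terminal_L(2,3) by (simp add: u2_def)
  next
    case False
    then have k: "Suc k < L" using that by simp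
    then have "ub (l + Suc k) \<in> U \<and> yb (l + Suc k) \<in> Y"
      using sol by (simp add: ocp_feasible_sol_def del: add_Suc_right)
    then show ?thesis using old[of "l + Suc k"] k by simp
  qed
  have feas: "feasible_sol (ext_state m p l ub yb 1) alpha' ?u ?y"
    unfolding ocp_feasible_sol_def
    using alpha' carr start constr terminal_L(1) shift[of L] by auto
  let ?s = "\<lambda>k. qf R (u2 (l + k) - us) + qf Q (y2 (l + k) - ys)"
  have "cost ?u ?y = (\<Sum>k<L. ?s (Suc k)) + qf P (ext_state m p l u2 y2 (Suc L) - xis)"
    unfolding ocp_cost_def shift by simp
  \<comment> \<open>The sum loses the first stage and gains the appended one, which the decrease of
    the terminal cost absorbs.\<close>
  also have "(\<Sum>k<L. ?s (Suc k)) = (\<Sum>k<L. ?s k) + ?s L - ?s 0"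
    using sum.lessThan_Suc_shift[of ?s L] by simp
  also have "(\<Sum>k<L. ?s k) = (\<Sum>k<L. qf R (ub (l + k) - us) + qf Q (yb (l + k) - ys))"
    by (rule sum.cong) (auto simp: old)
  also have "?s 0 = qf R (ub l - us) + qf Q (yb l - ys)"
    using old[of l] L_ge by simp
  also have "?s L = qf R (uL - us) + qf Q (y2 ?T - ys)"
    by (simp add: u2_def add.commute)
  finally have "cost ?u ?y \<le> cost ub yb - (qf R (ub l - us) + qf Q (yb l - ys))"
    using terminal_L(4) qfR dev by (simp add: ocp_cost_def xL_def)
  then show ?thesis using that feas by blast
qed

text \<open>Plant and prediction share the extended state and the current input, so
  \<open>GF_ext\<close>, applied to both, gives the same output although their internal states are
  never compared.\<close>

lemma closed_loop_step:
  assumes traj: "is_traj_inf n m A B C D u y"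
    and sol: "feasible_sol (ext_state m p l u y t) alpha ub yb" and u: "u (t + l) = ub l"
  shows "y (t + l) = yb l" "ext_state m p l u y (Suc t) = ext_state m p l ub yb 1"
proof -
  note c = is_traj_inf_carrier[OF D traj]
  have start: "ext_state m p l ub yb 0 = ext_state m p l u y t"
    and bc: "\<And>j. j < L + l \<Longrightarrow> ub j \<in> carrier_vec m" "\<And>j. j < L + l \<Longrightarrow> yb j \<in> carrier_vec p"
    using sol by (auto simp: ocp_feasible_sol_def)
  have "y (t + l) = Ct m p l G F *\<^sub>v ext_state m p l u y t + D *\<^sub>v u (t + l)"
    using GF_ext[OF is_traj_inf_imp_is_traj[OF traj], of "t + l" "Suc (t + l)"] by simp
  moreover have "yb l = Ct m p l G F *\<^sub>v ext_state m p l ub yb 0 + D *\<^sub>v ub l"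
    using GF_ext[OF feasible_sol_is_traj[OF sol], of l] L_ge by simp
  ultimately show y: "y (t + l) = yb l" using u start by simp
  have "u (t + j) = ub j" "y (t + j) = yb j" if "j < l" for j
    using ext_state_eqD[OF start that] bc[of j] c that by simp_all
  then have *: "u (t + j) = ub j \<and> y (t + j) = yb j" if "j \<le> l" for j
    using that u y by (cases "j = l") auto
  show "ext_state m p l u y (Suc t) = ext_state m p l ub yb 1"
    by (rule ext_state_cong) (use *[of "Suc _"] in auto)
qed

end

text \<open>The weights \<open>j + 1\<close> make \<open>\<Sum>j<l. (j + 1) * s (t + j)\<close> lose the whole window sum in each step, which
  compensates for the decrease of \<open>V\<close> involving only the newest summand.\<close>
lemma window_sum_exponential_decay:
  fixes V s :: "nat \<Rightarrow> real"
  assumes l: "1 \<le> l" and c: "0 < c" and cu: "0 < cu" and s: "\<And>k. 0 \<le> s k"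
    and V0: "\<And>t. 0 \<le> V t" and Vcu: "\<And>t. V t \<le> cu * (\<Sum>j<l. s (t + j))"
    and dec: "\<And>t. V (Suc t) \<le> V t - c * s (t + l)"
  shows "(\<Sum>j<l. s (t + j)) \<le> real l * (cu + c) / c * (1 - c / (real l * (cu + c))) ^ t * (\<Sum>j<l. s j)"
proof -
  define E where "E t = (\<Sum>j<l. s (t + j))" for t
  define \<Phi> where "\<Phi> t = (\<Sum>j<l. real (Suc j) * s (t + j))" for t
  \<comment> \<open>With the factor c/l the newest summand enters \<open>\<Phi>\<close> with total
    weight \<open>c\<close>, exactly what the decrease of \<open>V\<close> pays for; what remains is
    a loss of c/l times \<open>E t\<close>.\<close>
  define W where "W t = V t + c / l * \<Phi> t" for t
  \<comment> \<open>From \<open>\<Phi> t \<le> l * E t\<close> follows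
    \<open>W t \<le> (cu + c) * E t\<close>, so the loss c/l times \<open>E t\<close> is at least
    the fraction c / (l (cu + c)) of \<open>W t\<close>.\<close>
  define \<rho> where "\<rho> = 1 - c / (real l * (cu + c))"
  have lr: "0 < real l" using l by simp
  have "real l * (cu + c) \<ge> 1 * (cu + c)" using l c cu by (intro mult_right_mono) auto
  then have \<rho>0: "0 \<le> \<rho>" using c cu lr unfolding \<rho>_def by (simp add: field_simps)
  have \<Phi>_step: "\<Phi> (Suc t) = \<Phi> t - E t + real l * s (t + l)" for t
  proof -
    have "\<Phi> t - E t = (\<Sum>j<l. real j * s (t + j))"
      unfolding \<Phi>_def E_def sum_subtractf[symmetric] by (rule sum.cong) (auto simp: algebra_simps)
    moreover have "\<Phi> (Suc t) = (\<Sum>j<l. real (Suc j) * s (t + Suc j))" by (simp add: \<Phi>_def)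
    moreover have "\<dots> = (\<Sum>j<l. real j * s (t + j)) + real l * s (t + l)"
      using sum.lessThan_Suc_shift[of "\<lambda>j. real j * s (t + j)" l] by simp
    ultimately show ?thesis by simp
  qed
  have E_le: "E t \<le> \<Phi> t" for t
    unfolding E_def \<Phi>_def by (intro sum_mono) (use s in \<open>auto simp: algebra_simps\<close>)
  have \<Phi>_le: "\<Phi> t \<le> l * E t" for t
    unfolding E_def \<Phi>_def sum_distrib_left by (intro sum_mono mult_right_mono) (use s in auto)
  have W_le: "W t \<le> (cu + c) * E t" for t
  proof -
    have "c / l * \<Phi> t \<le> c / l * (l * E t)" using \<Phi>_le c lr by (intro mult_left_mono) auto
    then show ?thesis using Vcu[of t] lr by (simp add: W_def E_def algebra_simps)
  qed
  have W_ge: "c / l * E t \<le> W t" for t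
  proof -
    have "c / l * E t \<le> c / l * \<Phi> t" using E_le c lr by (intro mult_left_mono) auto
    then show ?thesis using V0[of t] by (simp add: W_def)
  qed
  have W_step: "W (Suc t) \<le> \<rho> * W t" for t
  proof -
    have "c / l * \<Phi> (Suc t) = c / l * \<Phi> t - c / l * E t + c * s (t + l)"
      using lr by (simp add: \<Phi>_step field_simps)
    then have "W (Suc t) \<le> W t - c / l * E t"
      using dec[of t] by (simp add: W_def)
    also have "\<dots> \<le> W t - c / l * (W t / (cu + c))"
      using W_le[of t] c cu lr by (intro diff_left_mono mult_left_mono) (auto simp: field_simps)
    also have "\<dots> = \<rho> * W t" using c cu lr by (simp add: \<rho>_def field_simps)
    finally show ?thesis .
  qed
  have "W t \<le> \<rho> ^ t * W 0"
  proof (induction t)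
    case (Suc t)
    have "W (Suc t) \<le> \<rho> * (\<rho> ^ t * W 0)"
      using W_step[of t] mult_left_mono[OF Suc \<rho>0] by linarith
    then show ?case by (simp add: mult.assoc)
  qed simp
  also have "\<dots> \<le> \<rho> ^ t * ((cu + c) * E 0)" using W_le[of 0] \<rho>0 by (intro mult_left_mono) auto
  finally have "c / l * E t \<le> \<rho> ^ t * ((cu + c) * E 0)" using W_ge[of t] by linarith
  then have "E t \<le> real l * (cu + c) / c * \<rho> ^ t * E 0"
    using c lr by (simp add: field_simps)
  then show ?thesis by (simp add: E_def \<rho>_def)
qed

section \<open>Assembly of the closed-loop result\<close>

lemma interior_pt_mem:
  assumes "interior_pt d S x" shows "x \<in> S"
proof -
  have "x \<in> carrier_vec d" "\<exists>e>0. \<forall>z \<in> carrier_vec d. vnorm (z - x) < e \<longrightarrow> z \<in> S"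
    using assms by (auto simp: interior_pt_def)
  moreover have "vnorm (x - x) = 0" using \<open>x \<in> carrier_vec d\<close> by (simp add: vnorm_def)
  ultimately show ?thesis by auto
qed

lemma traj_zero_state_dim:
  assumes C: "C \<in> carrier_mat p 0" and D: "D \<in> carrier_mat p m"
    and traj: "is_traj 0 m A B C D N u y" and k: "k < N"
    and dim: "A \<in> carrier_mat 0 0" "B \<in> carrier_mat 0 m"
  shows "y k = D *\<^sub>v u k"
proof -
  obtain x where x0: "x 0 \<in> carrier_vec 0"
    and u: "\<And>k. k < N \<Longrightarrow> u k \<in> carrier_vec m"
    and x: "\<And>k. k < N \<Longrightarrow> x (Suc k) = A *\<^sub>v x k + B *\<^sub>v u k"
    and y: "\<And>k. k < N \<Longrightarrow> y k = C *\<^sub>v x k + D *\<^sub>v u k"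
    using traj unfolding is_traj_def by blast
  have "x k \<in> carrier_vec 0" using state_carrier[OF dim x0 x u, of k] k by simp
  then show ?thesis unfolding y[OF k]
    using C D by (intro eq_vecI) (auto simp: scalar_prod_def)
qed

text \<open>Sequences are indexed from the first past measurement:
  \<open>ext_state m p l u y t\<close> is the extended state at time \<open>t\<close>, and
  \<open>u (t + l)\<close> is the input applied then. The constants precede the quantified
  trajectories, so they are uniform.\<close>

theorem theorem2:
  fixes n m p l L N :: nat
    and A B C D Q R P K :: "real mat"
    and G F :: "nat \<Rightarrow> real mat"
    and ud yd :: "nat \<Rightarrow> real vec"
    and U Y Xf :: "real vec set"
    and us ys :: "real vec"
  defines "xis \<equiv> ext_state m p l (\<lambda>_. us) (\<lambda>_. ys) 0"
  assumes dims: "A \<in> carrier_mat n n" "B \<in> carrier_mat n m" "C \<in> carrier_mat p n"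
      "D \<in> carrier_mat p m"
    and ctrb: "controllable n m A B"
    and obsv: "observable n p A C"
    and l_ge: "lag n p A C \<le> l"
    and GF_dims: "\<forall>i\<in>{1..l}. G i \<in> carrier_mat p m \<and> F i \<in> carrier_mat p p"
    and GF_ext: "\<forall>N' u y. is_traj n m A B C D N' u y \<longrightarrow>
        (\<forall>k. l \<le> k \<and> k < N' \<longrightarrow>
           y k = Ct m p l G F *\<^sub>v ext_state m p l u y (k - l) + D *\<^sub>v u k)"
    and data: "is_traj n m A B C D N ud yd"
    and UY: "U \<subseteq> carrier_vec m" "Y \<subseteq> carrier_vec p"
    and eq: "equilibrium n m p A B C D us ys"
    and eq_int: "interior_pt (m + p) {u @\<^sub>v y | u y. u \<in> U \<and> y \<in> Y} (us @\<^sub>v ys)"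
    and QR: "pos_def p Q" "pos_def m R"
    and L_ge: "1 \<le> L"
    and A1_P: "pos_def ((m + p) * l) P"
    and A1_K: "K \<in> carrier_mat m ((m + p) * l)"
    and A1_Xf: "Xf \<subseteq> prod_constr m p l U Y" "interior_pt ((m + p) * l) Xf xis"
    and A1: "\<forall>xi\<in>Xf.
        let u = us + K *\<^sub>v (xi - xis); y = Ct m p l G F *\<^sub>v xi + D *\<^sub>v u in
          At m p l G F *\<^sub>v xi + Bt m p l D *\<^sub>v u \<in> Xf \<and>
          u \<in> U \<and> y \<in> Y \<and>
          qf P ((At m p l G F + Bt m p l D * K) *\<^sub>v (xi - xis))
            \<le> qf P (xi - xis) - qf (transpose_mat K * R * K) (xi - xis) - qf Q (y - ys)"
    and A2: "\<exists>cu>0. \<forall>xi. ocp_feasible m p l L N ud yd U Y Xf xi \<longrightarrow>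
        ocp_value m p l L N ud yd U Y Xf Q R P us ys xis xi \<le> cu * (vnorm (xi - xis))\<^sup>2"
    and A3: "pers_exc m (L + l + n) N ud"
  shows "\<exists>c lam. c > 0 \<and> 0 < lam \<and> lam < 1 \<and>
     (\<forall>u y. is_traj_inf n m A B C D u y \<longrightarrow>
        (\<forall>t. ocp_feasible m p l L N ud yd U Y Xf (ext_state m p l u y t) \<longrightarrow>
           (\<exists>alpha ub yb. ocp_optimal_sol m p l L N ud yd U Y Xf Q R P us ys xis
                (ext_state m p l u y t) alpha ub yb \<and> u (t + l) = ub l)) \<longrightarrow>
        ocp_feasible m p l L N ud yd U Y Xf (ext_state m p l u y 0) \<longrightarrow>
        (\<forall>t. ocp_feasible m p l L N ud yd U Y Xf (ext_state m p l u y t)) \<and>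
        (\<forall>t. u (t + l) \<in> U \<and> y (t + l) \<in> Y) \<and>
        (\<forall>t. vnorm (ext_state m p l u y t - xis)
               \<le> c * lam ^ t * vnorm (ext_state m p l u y 0 - xis)))"
proof -
  let ?feas = "ocp_feasible m p l L N ud yd U Y Xf"
  let ?opt = "ocp_optimal_sol m p l L N ud yd U Y Xf Q R P us ys xis"
  let ?val = "ocp_value m p l L N ud yd U Y Xf Q R P us ys xis"
  let ?xi = "ext_state m p l"
  define closed_loop where "closed_loop u y \<longleftrightarrow> is_traj_inf n m A B C D u y \<and>
      (\<forall>t. ?feas (?xi u y t) \<longrightarrow> (\<exists>alpha ub yb. ?opt (?xi u y t) alpha ub yb \<and> u (t + l) = ub l)) \<and>
      ?feas (?xi u y 0)" for u y
  note Ac = dims(1) and Bc = dims(2) and Cc = dims(3) and Dc = dims(4)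
  have us: "us \<in> carrier_vec m" and ys: "ys \<in> carrier_vec p"
    using eq by (auto simp: equilibrium_def)
  have xisc: "xis \<in> carrier_vec ((m + p) * l)" by (simp add: xis_def)
  have "us @\<^sub>v ys \<in> {u @\<^sub>v y | u y. u \<in> U \<and> y \<in> Y}" using interior_pt_mem[OF eq_int] .
  then obtain u0 y0 where "us @\<^sub>v ys = u0 @\<^sub>v y0" "u0 \<in> U" "y0 \<in> Y" by blast
  moreover from this have "us = u0 \<and> ys = y0"
    using append_vec_eq[of us m u0 ys y0] us UY by auto
  ultimately have usU: "us \<in> U" and ysY: "ys \<in> Y" by auto
  obtain cu where cu: "0 < cu" and val_le: "\<And>xi. ?feas xi \<Longrightarrow> ?val xi \<le> cu * (vnorm (xi - xis))\<^sup>2"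
    using A2 by blast
  have "\<exists>c lam. c > 0 \<and> 0 < lam \<and> lam < 1 \<and> (\<forall>u y. closed_loop u y \<longrightarrow>
      (\<forall>t. ?feas (?xi u y t)) \<and> (\<forall>t. u (t + l) \<in> U \<and> y (t + l) \<in> Y) \<and>
      (\<forall>t. vnorm (?xi u y t - xis) \<le> c * lam ^ t * vnorm (?xi u y 0 - xis)))"
  proof (cases "m = 0 \<or> l = 0")
    \<comment> \<open>If \<open>n = 0\<close>, the lag is an unspecified value, so \<open>l = 0\<close> cannot be excluded. Only outside
      this case does persistency of excitation force \<open>L + l + n \<le> N\<close>; otherwise the truncated
      subtraction in the Hankel matrix may expose entries beyond the recorded data.\<close>
    case degenerate: True
    \<comment> \<open>For \<open>m = 0\<close> the controllability matrix has no columns, hence rank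
      0; for \<open>l = 0\<close> a positive \<open>n\<close> would contradict
      \<open>1 \<le> lag n p A C\<close>.\<close>
    have n0: "n = 0"
    proof (cases "m = 0")
      case True
      then show ?thesis
        using ctrb mrank_le_dim_col[of "ctrb_mat n m A B" n "n * m"]
        by (simp add: controllable_def ctrb_mat_def)
    next
      case False
      then show ?thesis using degenerate lag_properties(1)[OF obsv] l_ge by fastforce
    qed
    have "ys = D *\<^sub>v us"
      using traj_zero_state_dim[of C p D m A B "Suc (lag n p A C)" "\<lambda>_. us" "\<lambda>_. ys" 0] eq dims n0
      by (simp add: equilibrium_def)
    then have y_eq: "y k = ys" if "is_traj_inf n m A B C D u y" "u k = us" for u y k
      using traj_zero_state_dim[of C p D m A B "Suc k" u y k] dims n0 that is_traj_inf_imp_is_traj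
      by simp
    \<comment> \<open>The window is empty if \<open>l = 0\<close>; if \<open>m = 0\<close>, its
      inputs are empty vectors and the static system returns \<open>ys\<close>.\<close>
    have xi_eq: "?xi u y t = xis" if "closed_loop u y" for u y t
      unfolding xis_def
    proof (rule ext_state_cong)
      fix j assume "j < l"
      then have "u (t + j) \<in> carrier_vec 0"
        using degenerate is_traj_inf_carrier(1)[OF Dc] that by (metis closed_loop_def not_less0)
      then show "u (t + j) = us" using us degenerate \<open>j < l\<close> by auto
      then show "y (t + j) = ys" using y_eq that unfolding closed_loop_def by blast
    qed
    have feas: "?feas (?xi u y t)" if "closed_loop u y" for u y t
      using that xi_eq[OF that] by (simp add: closed_loop_def)
    have u_eq: "u (t + l) = us" if cl: "closed_loop u y" for u y t
    proof -
      obtain alpha ub yb where opt: "?opt (?xi u y t) alpha ub yb" and u: "u (t + l) = ub l"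
        using cl feas[OF cl] unfolding closed_loop_def by blast
      have sol: "ocp_feasible_sol m p l L N ud yd U Y Xf (?xi u y t) alpha ub yb"
        using opt by (simp add: ocp_optimal_sol_def)
      \<comment> \<open>A2 at \<open>xis\<close> bounds the value by zero, and the cost dominates
        the first stage.\<close>
      have "?val (?xi u y t) \<le> 0"
        using val_le[OF feas[OF cl, of t]] xi_eq[OF cl, of t] xisc by (simp add: vnorm_def)
      then have "qf R (ub l - us) = 0"
        using optimal_imp_value_eq_cost[OF opt] ocp_cost_ge_stage[OF QR A1_P xisc us ys L_ge sol]
        by linarith
      moreover have ubc: "ub l \<in> carrier_vec m" using sol L_ge by (simp add: ocp_feasible_sol_def)
      ultimately have z: "ub l - us = 0\<^sub>v m"
        using QR(2) us unfolding pos_def_def qf_def by (metis less_irrefl minus_carrier_vec)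
      have "ub l = us"
      proof (rule eq_vecI)
        fix i assume "i < dim_vec us"
        then have "i < m" using us by simp
        then show "ub l $ i = us $ i" using arg_cong[OF z, of "\<lambda>v. v $ i"] us by simp
      qed (use ubc us in simp)
      then show ?thesis using u by simp
    qed
    have y_l: "y (t + l) = ys" if "closed_loop u y" for u y t
      using y_eq u_eq[OF that] that unfolding closed_loop_def by blast
    have norm: "vnorm (?xi u y t - xis) \<le> 1 * (1/2) ^ t * vnorm (?xi u y 0 - xis)"
      if "closed_loop u y" for u y t
      unfolding xi_eq[OF that] using xisc by (simp add: vnorm_def)
    have "(\<forall>t. ?feas (?xi u y t)) \<and> (\<forall>t. u (t + l) \<in> U \<and> y (t + l) \<in> Y) \<and>
        (\<forall>t. vnorm (?xi u y t - xis) \<le> 1 * (1/2) ^ t * vnorm (?xi u y 0 - xis))"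
      if "closed_loop u y" for u y
      using feas[OF that] u_eq[OF that] y_l[OF that] norm[OF that] usU ysY by metis
    then show ?thesis by (intro exI[of _ "1 :: real"] exI[of _ "1/2 :: real"]) simp
  next
    case False
    then have m1: "1 \<le> m" and l1: "1 \<le> l" by auto
    \<comment> \<open>If the data were too short, truncation would leave a single column and rank at
      most 1, while the required rank is at least 2.\<close>
    have N_ge: "L + l + n \<le> N"
    proof (rule ccontr)
      assume "\<not> ?thesis"
      then have "m * (L + l + n) \<le> 1"
        using A3 mrank_le_dim_col[OF hankel_carrier[of m "L + l + n" N ud]] by (simp add: pers_exc_def)
      moreover have "1 * 2 \<le> m * (L + l + n)" using m1 l1 L_ge by (intro mult_le_mono) auto
      ultimately show False by simp
    qed
    interpret data_driven_mpc n m p l L N A B C D Q R P K G F ud yd U Y Xf us ys xis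
      by unfold_locales
        (use dims ctrb obsv GF_ext data eq QR L_ge A1_P A1_K A1 A3 N_ge in \<open>auto simp: xis_def\<close>)
    obtain cR where cR: "0 < cR" "\<And>x. x \<in> carrier_vec m \<Longrightarrow> cR * (x \<bullet> x) \<le> qf R x"
      using pos_def_lower_bound[OF QR(2)] by blast
    obtain cQ where cQ: "0 < cQ" "\<And>x. x \<in> carrier_vec p \<Longrightarrow> cQ * (x \<bullet> x) \<le> qf Q x"
      using pos_def_lower_bound[OF QR(1)] by blast
    define c where "c = min cR cQ"
    have c0: "0 < c" using cR cQ by (simp add: c_def)
    define \<rho> where "\<rho> = 1 - c / (real l * (cu + c))"
    define M where "M = real l * (cu + c) / c"
    have lr: "1 \<le> real l" using l1 by simp
    \<comment> \<open>Strictness comes from \<open>cu > 0\<close> and keeps the rate strictly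
      positive even for \<open>l = 1\<close>.\<close>
    have "c < 1 * (cu + c)" using cu by simp
    also have "\<dots> \<le> real l * (cu + c)" using lr c0 cu by (intro mult_right_mono) auto
    finally have "c < real l * (cu + c)" .
    moreover from this have "0 < real l * (cu + c)" using c0 by (rule less_trans[rotated])
    ultimately have \<rho>: "0 < \<rho>" "\<rho> < 1" and M: "0 < M" using c0 by (auto simp: \<rho>_def M_def)
    have main: "(\<forall>t. ?feas (?xi u y t)) \<and> (\<forall>t. u (t + l) \<in> U \<and> y (t + l) \<in> Y) \<and>
        (\<forall>t. vnorm (?xi u y t - xis) \<le> sqrt M * sqrt \<rho> ^ t * vnorm (?xi u y 0 - xis))"
      if cl: "closed_loop u y" for u y
    proof -
      have traj: "is_traj_inf n m A B C D u y" using cl by (simp add: closed_loop_def)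
      note carr = is_traj_inf_carrier[OF Dc traj]
      define V where "V t = ?val (?xi u y t)" for t
      define stage where "stage t = qf R (u (t + l) - us) + qf Q (y (t + l) - ys)" for t
      \<comment> \<open>The decrease is conditional on a minimiser at \<open>Suc t\<close>: the
        closed loop provides one only once feasibility at \<open>Suc t\<close> is known, and that is
        settled by the induction below.\<close>
      have step: "?feas (?xi u y (Suc t)) \<and> u (t + l) \<in> U \<and> y (t + l) \<in> Y \<and>
          0 \<le> V t \<and> (\<forall>alpha ub yb. ?opt (?xi u y (Suc t)) alpha ub yb \<longrightarrow> V (Suc t) \<le> V t - stage t)"
        if ft: "?feas (?xi u y t)" for t
      proof -
        obtain alpha ub yb where opt: "?opt (?xi u y t) alpha ub yb" and u: "u (t + l) = ub l"
          using cl ft unfolding closed_loop_def by blast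
        have sol: "feasible_sol (?xi u y t) alpha ub yb" using opt by (simp add: ocp_optimal_sol_def)
        note cls = closed_loop_step[OF traj sol u]
        have V: "V t = cost ub yb" unfolding V_def by (rule optimal_imp_value_eq_cost[OF opt])
        obtain alpha' ub' yb' where cand: "feasible_sol (?xi u y (Suc t)) alpha' ub' yb'"
          "cost ub' yb' \<le> cost ub yb - (qf R (ub l - us) + qf Q (yb l - ys))"
          using shifted_candidate[OF sol] cls(2) by metis
        have "V (Suc t) \<le> V t - stage t" if "?opt (?xi u y (Suc t)) a v w" for a v w
        proof -
          have "V (Suc t) = cost v w" unfolding V_def by (rule optimal_imp_value_eq_cost[OF that])
          also have "\<dots> \<le> cost ub' yb'" using that cand(1) by (auto simp: ocp_optimal_sol_def)
          finally show ?thesis using cand(2) V u cls(1) by (simp add: stage_def)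
        qed
        moreover have "ub l \<in> U" "yb l \<in> Y"
          using sol L_ge unfolding ocp_feasible_sol_def by (metis add.right_neutral less_eq_Suc_le One_nat_def)+
        ultimately show ?thesis
          using cand(1) u cls(1) V ocp_cost_ge_stage[OF QR A1_P xisc us ys L_ge sol]
          by (auto simp: ocp_feasible_def)
      qed
      have feas: "?feas (?xi u y t)" for t
        by (induction t) (use cl step in \<open>auto simp: closed_loop_def\<close>)
      have dec: "V (Suc t) \<le> V t - stage t" for t
        using step[OF feas] feas[of "Suc t"] cl unfolding closed_loop_def by blast
      define s where "s k = (u k - us) \<bullet> (u k - us) + (y k - ys) \<bullet> (y k - ys)" for k
      have s0: "0 \<le> s k" for k by (simp add: s_def scalar_prod_self_nonneg)
      have stage_ge: "c * s (t + l) \<le> stage t" for t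
      proof -
        have "c * ((u (t + l) - us) \<bullet> (u (t + l) - us)) \<le> cR * ((u (t + l) - us) \<bullet> (u (t + l) - us))"
          "c * ((y (t + l) - ys) \<bullet> (y (t + l) - ys)) \<le> cQ * ((y (t + l) - ys) \<bullet> (y (t + l) - ys))"
          by (auto simp: c_def intro!: mult_right_mono scalar_prod_self_nonneg)
        moreover have "u (t + l) - us \<in> carrier_vec m" "y (t + l) - ys \<in> carrier_vec p"
          using carr us ys by auto
        ultimately show ?thesis
          using cR(2)[of "u (t + l) - us"] cQ(2)[of "y (t + l) - ys"]
          by (simp add: s_def stage_def distrib_left)
      qed
      have norm_sq: "(?xi u y t - xis) \<bullet> (?xi u y t - xis) = (\<Sum>j<l. s (t + j))" for t
        unfolding xis_def ext_state_minus[OF us ys]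
        by (subst ext_state_sq_norm) (use carr us ys in \<open>auto simp: s_def\<close>)
      have vn: "vnorm (?xi u y t - xis) = sqrt (\<Sum>j<l. s (t + j))" for t
        by (simp add: vnorm_def norm_sq)
      have "(\<Sum>j<l. s (t + j)) \<le> M * \<rho> ^ t * (\<Sum>j<l. s j)" for t
        unfolding M_def \<rho>_def
      proof (rule window_sum_exponential_decay[OF l1 c0 cu s0])
        fix t
        show "0 \<le> V t" using step[OF feas] by blast
        show "V t \<le> cu * (\<Sum>j<l. s (t + j))"
          using val_le[OF feas, of t] s0 by (simp add: V_def vn sum_nonneg)
        show "V (Suc t) \<le> V t - c * s (t + l)" using dec[of t] stage_ge[of t] by linarith
      qed
      \<comment> \<open>The window sums are squared norms, so constant and rate both pass to their
        square roots.\<close>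
      then have "sqrt (\<Sum>j<l. s (t + j)) \<le> sqrt (M * \<rho> ^ t * (\<Sum>j<l. s j))" for t
        by (rule real_sqrt_le_mono)
      then have "vnorm (?xi u y t - xis) \<le> sqrt M * sqrt \<rho> ^ t * vnorm (?xi u y 0 - xis)" for t
        by (simp add: vn real_sqrt_mult real_sqrt_power)
      then show ?thesis using feas step[OF feas] by blast
    qed
    moreover have "0 < sqrt M" "0 < sqrt \<rho>" "sqrt \<rho> < 1" using M \<rho> by simp_all
    ultimately show ?thesis by blast
  qed
  then show ?thesis unfolding closed_loop_def imp_conjL .
qed

end
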